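(* Fix a time slot and an active sensor $k\in\mathcal K_a$. Let $$\tilde{\mathcal E}_k=(1-\alpha)\Delta\,\zeta\,\delta\,\theta_k\,\rho_dN^2\Big(\sum_{l=1}^L\sqrt{\eta_{l,k}}\,\gamma_{l,k}\Big)^2,\qquad \bar{\mathcal E}_k=(1-\alpha)\Delta\,\zeta\,\delta\,\theta_k\,\rho_dN^2\Big(\sum_{l=1}^L\sqrt{\eta_{l,k}}\,\bar\gamma_{l,k}\Big)^2 .$$ Then, as $\tau\to\infty$ with $\alpha=\tau/T_c$, $\kappa=\tau/K_a$ and $E_p$ fixed, $$\tilde{\mathcal E}_k-\bar{\mathcal E}_k\xrightarrow{\text{a.s.}}0,\qquad k\in\mathcal K_a .$$
   Context: Setting (one fixed time slot; the slot index is suppressed). There are $L$ access points (APs) with $N$ antennas each and a set $\mathcal K$ of sensors. $\beta_{l,j}>0$ is the large-scale fading coefficient between AP $l$ and sensor $j$. $\mathcal K_a\subseteq\mathcal K$ is the (deterministic) set of active sensors, $|\mathcal K_a|=K_a$; $\theta_j=1$ if $j\in\mathcal K_a$ and $0$ otherwise. $\delta\in\{0,1\}$ is the power-transfer mode indicator, $\Delta$ the slot duration, $\zeta\in(0,1)$ the energy conversion efficiency, $\rho_d>0$ the downlink power, $T_c$ the number of symbols per slot, $\tau$ the pilot length, $\alpha=\tau/T_c$, $\rho_p$ the pilot power, $\sigma^2>0$ the noise power, $E_p=\tau\rho_p/\sigma^2$. $\eta_{l,j}\ge0$ are downlink power control coefficients, subject to the AP power constraint $\sum_{j}\delta\,\theta_j\eta_{l,j}\gamma_{l,j}\le1$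 for all $l$. The pilots $\psi_j\sim\mathcal{CN}(0,\frac1\tau I_\tau)$, $j\in\mathcal K$, are independent random vectors in $\mathbb C^\tau$. The limit is $\tau\to\infty$ with $\alpha$, $\kappa=\tau/K_a$ and $E_p$ held fixed; the other parameters $L,N,\rho_d,\zeta,\Delta,\sigma^2$ and the coefficients $\beta_{l,j},\eta_{l,j}$ attached to each sensor do not depend on $\tau$. Pilot-dependent: $Z_l=I_\tau+\sum_{j\in\mathcal K_a}E_p\beta_{l,j}\psi_j\psi_j^H$ and $\gamma_{l,k}=E_p\beta_{l,k}^2\psi_k^HZ_l^{-1}\psi_k$ for $k\in\mathcal K_a$ (the mean squared value of the LMMSE channel estimate). The quantity $\tilde{\mathcal E}_k$ is a lower bound on the energy harvested by sensor $k$ in the slot. Deterministic: for each $l$ and $k\in\mathcal K_a$, let $(\varsigma_j)_{j\in\mathcal K_a\setminus\{k\}}$ be the unique positive solution of $\varsigma_j=E_p\beta_{l,j}\big[1+\sum_{i\in\mathcal K_a\setminus\{k\}}\frac{E_p\beta_{l,i}}{\tau(1+\varsigma_i)}\big]^{-1}$, set $\mathcal Z_{l,k}=\big[1+\sum_{j\in\mathcal K_a\setminus\{k\}}\frac{E_p\beta_{l,j}}{\tau(1+\varsigma_j)}\big]^{-1}$ and $\bar\gamma_{l,k}=\frac{E_p\beta_{l,k}^2\mathcal Z_{l,k}}{1+E_p\beta_{l,k}\mathcal Z_{l,k}}$. *)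

theory Defs
  imports
    "HOL-Probability.Probability"
    "Jordan_Normal_Form.Gauss_Jordan_Elimination"
    "Jordan_Normal_Form.Determinant"
begin

text \<open>
  The dimension of the pilot space grows along the limit, so a point of complex n-space is a
  function \<^typ>\<open>nat \<Rightarrow> complex\<close> read on the indices below n; it is turned into a vector of
  dimension n whenever matrices are involved.
\<close>

abbreviation complex_space :: "nat \<Rightarrow> (nat \<Rightarrow> complex) measure" where
  "complex_space n \<equiv> (\<Pi>\<^sub>M i\<in>{..<n}. (lborel :: complex measure))"

definition inv_form :: "nat \<Rightarrow> complex mat \<Rightarrow> (nat \<Rightarrow> complex) \<Rightarrow> real" where
  \<comment> \<open>\<open>z\<^sup>H A\<^sup>-\<^sup>1 z\<close>, which is real because A will always be Hermitian and positive definite\<close>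
  "inv_form n A z =
    (let v = Matrix.vec n z in Re ((the (mat_inverse A) *\<^sub>v v) \<bullet>c v))"

definition complex_normal_density :: "nat \<Rightarrow> complex mat \<Rightarrow> (nat \<Rightarrow> complex) \<Rightarrow> real" where
  \<comment> \<open>density of the circularly symmetric complex Gaussian law \<open>CN(0, C)\<close>\<close>
  "complex_normal_density n C z =
    exp (- inv_form n C z) / (pi ^ n * Re (Determinant.det C))"

definition Z_mat ::
  "nat \<Rightarrow> real \<Rightarrow> ('s \<Rightarrow> real) \<Rightarrow> 's set \<Rightarrow> ('s \<Rightarrow> nat \<Rightarrow> complex) \<Rightarrow> complex mat" where
  \<comment> \<open>the entry of \<open>\<psi> \<psi>\<^sup>H\<close> at (r, c) is \<open>\<psi> r * cnj (\<psi> c)\<close>\<close>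
  "Z_mat t Ep b A \<psi> =
    1\<^sub>m t + Matrix.mat t t (\<lambda>(r, c). \<Sum>j\<in>A. complex_of_real (Ep * b j) * (\<psi> j r * cnj (\<psi> j c)))"

definition gamma_lmmse ::
  "nat \<Rightarrow> real \<Rightarrow> ('s \<Rightarrow> real) \<Rightarrow> 's set \<Rightarrow> ('s \<Rightarrow> nat \<Rightarrow> complex) \<Rightarrow> 's \<Rightarrow> real" where
  "gamma_lmmse t Ep b A \<psi> k = Ep * (b k)\<^sup>2 * inv_form t (Z_mat t Ep b A \<psi>) (\<psi> k)"

text \<open>
  The solution of the fixed-point system is taken to be \<^const>\<open>undefined\<close> outside the index
  set J, so that it is unique as a function.
\<close>

definition fixed_point :: "nat \<Rightarrow> real \<Rightarrow> ('s \<Rightarrow> real) \<Rightarrow> 's set \<Rightarrow> 's \<Rightarrow> real" where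
  "fixed_point t Ep b J =
    (THE s. s \<in> J \<rightarrow>\<^sub>E {0<..} \<and>
       (\<forall>j\<in>J. s j = Ep * b j * inverse (1 + (\<Sum>i\<in>J. Ep * b i / (real t * (1 + s i))))))"

definition Z_det :: "nat \<Rightarrow> real \<Rightarrow> ('s \<Rightarrow> real) \<Rightarrow> 's set \<Rightarrow> real" where
  "Z_det t Ep b J =
    inverse (1 + (\<Sum>j\<in>J. Ep * b j / (real t * (1 + fixed_point t Ep b J j))))"

definition gamma_bar :: "nat \<Rightarrow> real \<Rightarrow> ('s \<Rightarrow> real) \<Rightarrow> 's set \<Rightarrow> 's \<Rightarrow> real" where
  "gamma_bar t Ep b A k =
    (let Z = Z_det t Ep b (A - {k}) in Ep * (b k)\<^sup>2 * Z / (1 + Ep * b k * Z))"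

definition energy ::
  "real \<Rightarrow> real \<Rightarrow> real \<Rightarrow> real \<Rightarrow> real \<Rightarrow> real \<Rightarrow> nat \<Rightarrow> nat \<Rightarrow> (nat \<Rightarrow> real) \<Rightarrow> (nat \<Rightarrow> real) \<Rightarrow> real"
  where
  "energy \<alpha> \<Delta> \<zeta> \<delta> \<theta> \<rho>\<^sub>d N L \<eta> g =
    (1 - \<alpha>) * \<Delta> * \<zeta> * \<delta> * \<theta> * \<rho>\<^sub>d * (real N)\<^sup>2 * (\<Sum>l=1..L. sqrt (\<eta> l) * g l)\<^sup>2"

end

theory Submission
  imports Defs
begin

text \<open>
  Write \<open>W J\<close> for the Gram matrix \<open>I + (\<Sum>j\<in>J. c j \<psi> j \<psi> j\<^sup>H)\<close> and \<open>M J\<close> for the normalised trace of its inverse.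
  For j outside J the pilot of j is independent of \<open>W J\<close>, and a Chernoff bound shows that
  \<open>q j = \<psi> j\<^sup>H W(J)\<^sup>-\<^sup>1 \<psi> j\<close> differs from \<open>M J\<close> by more than \<open>\<epsilon>\<close> with probability at most
  \<open>2 exp (- \<tau> \<epsilon>\<^sup>2 / 8)\<close>; this survives a union bound over all active sensors and is summable in \<open>\<tau>\<close>.
  Taking the trace of \<open>W W\<^sup>-\<^sup>1 = I\<close> and removing one pilot at a time (Sherman--Morrison) gives
  \<open>1 = M + (1/\<tau>) (\<Sum>j. c j q j / (1 + c j q j))\<close>, whereas the deterministic equivalent m satisfies
  \<open>1 = m + (1/\<tau>) (\<Sum>j. c j m / (1 + c j m))\<close>. The right-hand side increases in m with slope at least 1,
  hence \<open>\<bar>M - m\<bar> \<le> max\<^sub>j \<bar>q j - M\<bar>\<close>, uniformly in the (possibly unbounded) weights c.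
\<close>

subsection \<open>Matrices as functions on index pairs\<close>

text \<open>The active set changes with \<tau>, so \<beta> has no common bound over all sensors that
  ever occur and the norm of \<open>W J\<close> need not stay bounded. Everything is therefore drawn
  from \<open>W J\<close> \<ge> I alone: its inverse has norm at most 1, deleting a pilot moves the
  trace of the inverse by at most 1, and x / (1 + c x) is 1-Lipschitz on x \<ge> 0 when multiplied
  by no power of c. The estimate for sensor k is built on the active set without k, and its
  leave-one-out forms remove a further j; hence sets of the shape \<open>A - {k} - {j}\<close>,
  which for j = k is just \<open>A - {k}\<close>. The 8 in the exponent comes from minimising 2 s^2
  \<tau> - s \<tau> \<epsilon> at s = \<epsilon> / 4. The 2 there bounds the norm of the inverse of
  W - s I for \<bar>s\<bar> \<le> 1/2. Nothing links the pilots of different slots lengths \<tau>,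
  so almost sure convergence rests on summability only. The fixed-point system is a vector equation,
  but its right-hand side depends on j only through c j, so it collapses to one scalar unknown
  m.\<close>

definition mv :: "nat \<Rightarrow> (nat \<Rightarrow> nat \<Rightarrow> complex) \<Rightarrow> (nat \<Rightarrow> complex) \<Rightarrow> nat \<Rightarrow> complex" where
  "mv n A x = (\<lambda>r. \<Sum>s<n. A r s * x s)"

definition ip :: "nat \<Rightarrow> (nat \<Rightarrow> complex) \<Rightarrow> (nat \<Rightarrow> complex) \<Rightarrow> complex" where
  "ip n x y = (\<Sum>i<n. x i * cnj (y i))"

definition nsq :: "nat \<Rightarrow> (nat \<Rightarrow> complex) \<Rightarrow> real" where
  "nsq n x = (\<Sum>i<n. (cmod (x i))\<^sup>2)"

definition unit_fun :: "nat \<Rightarrow> nat \<Rightarrow> complex" where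
  "unit_fun r = (\<lambda>i. if i = r then 1 else 0)"

definition trc :: "nat \<Rightarrow> (nat \<Rightarrow> nat \<Rightarrow> complex) \<Rightarrow> complex" where
  "trc n A = (\<Sum>r<n. A r r)"

definition herm :: "nat \<Rightarrow> (nat \<Rightarrow> nat \<Rightarrow> complex) \<Rightarrow> bool" where
  "herm n A \<longleftrightarrow> (\<forall>r<n. \<forall>s<n. A s r = cnj (A r s))"

text \<open>The Loewner bound A \<ge> a I. The constant is kept because it controls the inverse: a =
  1 is used for Gram matrices and a = 1/2 for their shifts by s I.\<close>

definition bounded_below :: "nat \<Rightarrow> real \<Rightarrow> (nat \<Rightarrow> nat \<Rightarrow> complex) \<Rightarrow> bool" where
  "bounded_below n a A \<longleftrightarrow> 0 < a \<and> herm n A \<and> (\<forall>x. a * nsq n x \<le> Re (ip n (mv n A x) x))"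

definition pos_def :: "nat \<Rightarrow> (nat \<Rightarrow> nat \<Rightarrow> complex) \<Rightarrow> bool" where
  "pos_def n A \<longleftrightarrow> herm n A \<and> (\<forall>x. (\<exists>i<n. x i \<noteq> 0) \<longrightarrow> 0 < Re (ip n (mv n A x) x))"

text \<open>A relation that ignores entries outside the leading n by n block, so one H can serve as
  inverse in several dimensions; the Schur complement induction relies on this.\<close>

definition right_inverse :: "nat \<Rightarrow> (nat \<Rightarrow> nat \<Rightarrow> complex) \<Rightarrow> (nat \<Rightarrow> nat \<Rightarrow> complex) \<Rightarrow> bool" where
  "right_inverse n A H \<longleftrightarrow> (\<forall>r<n. \<forall>c<n. (\<Sum>s<n. A r s * H s c) = (if r = c then 1 else 0))"

lemma ip_cong: "(\<And>i. i < n \<Longrightarrow> x i = x' i) \<Longrightarrow> (\<And>i. i < n \<Longrightarrow> y i = y' i) \<Longrightarrow> ip n x y = ip n x' y'"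
  by (simp add: ip_def)

lemma mv_cong: "(\<And>i. i < n \<Longrightarrow> x i = x' i) \<Longrightarrow> mv n A x = mv n A x'"
  by (simp add: mv_def)

lemma ip_self: "ip n x x = complex_of_real (nsq n x)"
  by (simp add: ip_def nsq_def complex_norm_square del: of_real_power)

lemma cnj_ip: "cnj (ip n x y) = ip n y x"
  by (simp add: ip_def mult.commute)

lemma nsq_nonneg: "0 \<le> nsq n x"
  by (simp add: nsq_def sum_nonneg)

lemma nsq_pos_iff: "0 < nsq n x \<longleftrightarrow> (\<exists>i<n. x i \<noteq> 0)"
proof -
  have "nsq n x = 0 \<longleftrightarrow> (\<forall>i<n. x i = 0)"
    unfolding nsq_def by (subst sum_nonneg_eq_0_iff) auto
  then show ?thesis using nsq_nonneg[of n x] by force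
qed

lemma ip_add_left: "ip n (\<lambda>i. x i + y i) z = ip n x z + ip n y z"
  by (simp add: ip_def sum.distrib algebra_simps)

lemma ip_diff_left: "ip n (\<lambda>i. x i - y i) z = ip n x z - ip n y z"
  by (simp add: ip_def sum_subtractf algebra_simps)

lemma ip_scale_left: "ip n (\<lambda>i. c * x i) z = c * ip n x z"
  by (simp add: ip_def sum_distrib_left algebra_simps)

lemma ip_diff_right: "ip n z (\<lambda>i. x i - y i) = ip n z x - ip n z y"
  by (simp add: ip_def sum_subtractf algebra_simps)

lemma ip_scale_right: "ip n z (\<lambda>i. c * x i) = cnj c * ip n z x"
  by (simp add: ip_def sum_distrib_left algebra_simps)

lemma mv_add: "mv n A (\<lambda>i. x i + y i) r = mv n A x r + mv n A y r"
  by (simp add: mv_def sum.distrib algebra_simps)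

lemma mv_diff: "mv n A (\<lambda>i. x i - y i) r = mv n A x r - mv n A y r"
  by (simp add: mv_def sum_subtractf algebra_simps)

lemma mv_scale: "mv n A (\<lambda>i. c * x i) r = c * mv n A x r"
  by (simp add: mv_def sum_distrib_left algebra_simps)

lemma cauchy_schwarz: "cmod (ip n x y) \<le> sqrt (nsq n x) * sqrt (nsq n y)"
proof -
  have "cmod (ip n x y) \<le> (\<Sum>i<n. cmod (x i) * cmod (y i))"
    unfolding ip_def by (rule order_trans[OF norm_sum]) (simp add: norm_mult)
  also have "\<dots> \<le> sqrt (\<Sum>i<n. (cmod (x i))\<^sup>2) * sqrt (\<Sum>i<n. (cmod (y i))\<^sup>2)"
    using L2_set_mult_ineq[of "\<lambda>i. cmod (x i)" "\<lambda>i. cmod (y i)" "{..<n}"] by (simp add: L2_set_def)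
  finally show ?thesis by (simp add: nsq_def)
qed

lemma nsq_unit: "r < n \<Longrightarrow> nsq n (unit_fun r) = 1"
  by (simp add: nsq_def unit_fun_def if_distrib[of "\<lambda>z. (cmod z)\<^sup>2"] cong: if_cong)

lemma mv_unit: "c < n \<Longrightarrow> mv n A (unit_fun c) r = A r c"
  by (simp add: mv_def unit_fun_def mult_delta_right)

lemma ip_unit_right: "r < n \<Longrightarrow> ip n x (unit_fun r) = x r"
  by (simp add: ip_def unit_fun_def if_distrib[of cnj] mult_delta_right cong: if_cong)

lemma ip_unit_left: "r < n \<Longrightarrow> ip n (unit_fun r) x = cnj (x r)"
  by (simp add: ip_def unit_fun_def mult_delta_left)

lemma ip_mv_herm:
  assumes "herm n A"
  shows "ip n (mv n A x) y = ip n x (mv n A y)"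
proof -
  have "ip n (mv n A x) y = (\<Sum>r<n. \<Sum>s<n. A r s * x s * cnj (y r))"
    by (simp add: ip_def mv_def sum_distrib_right)
  also have "\<dots> = (\<Sum>s<n. \<Sum>r<n. x s * cnj (A s r * y r))"
  proof (subst sum.swap, intro sum.cong refl)
    fix s r assume "s \<in> {..<n}" "r \<in> {..<n}"
    then have "A r s = cnj (A s r)" using assms unfolding herm_def by blast
    then show "A r s * x s * cnj (y r) = x s * cnj (A s r * y r)" by simp
  qed
  finally show ?thesis by (simp add: ip_def mv_def sum_distrib_left)
qed

lemma mv_right_inverse:
  assumes "right_inverse n A H" "r < n"
  shows "mv n A (mv n H x) r = x r"
proof -
  have "mv n A (mv n H x) r = (\<Sum>s<n. \<Sum>c<n. A r s * H s c * x c)"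
    by (simp add: mv_def sum_distrib_left algebra_simps)
  also have "\<dots> = (\<Sum>c<n. (\<Sum>s<n. A r s * H s c) * x c)"
    by (subst sum.swap) (simp add: sum_distrib_right)
  also have "\<dots> = (\<Sum>c<n. if c = r then x r else 0)"
    using assms by (intro sum.cong) (auto simp: right_inverse_def)
  finally show ?thesis using assms(2) by simp
qed

lemma right_inverseI:
  assumes "\<And>r c. r < n \<Longrightarrow> c < n \<Longrightarrow> mv n A (mv n H (unit_fun c)) r = unit_fun c r"
  shows "right_inverse n A H"
proof -
  have "(\<Sum>s<n. A r s * H s c) = mv n A (mv n H (unit_fun c)) r" if "c < n" for r c
    by (simp only: mv_def[of n A] mv_unit[OF that])
  then show ?thesis using assms by (auto simp: right_inverse_def unit_fun_def)
qed

text \<open>Inserting A H in front of y and moving A across gives <H x, y> = <H x, A H y> = <A H x,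
  H y> = <x, H y>; unit vectors then read off the entries.\<close>

lemma herm_right_inverse:
  assumes "herm n A" "right_inverse n A H"
  shows "herm n H"
  unfolding herm_def
proof safe
  fix r s assume rs: "r < n" "s < n"
  have *: "ip n (mv n H x) y = ip n x (mv n H y)" for x y
  proof -
    have "ip n (mv n H x) y = ip n (mv n H x) (mv n A (mv n H y))"
      using mv_right_inverse[OF assms(2)] by (intro ip_cong) auto
    also have "\<dots> = ip n (mv n A (mv n H x)) (mv n H y)"
      using ip_mv_herm[OF assms(1)] by simp
    also have "\<dots> = ip n x (mv n H y)"
      using mv_right_inverse[OF assms(2)] by (intro ip_cong) auto
    finally show ?thesis .
  qed
  show "H s r = cnj (H r s)"
    using *[of "unit_fun r" "unit_fun s"] rs by (simp add: ip_unit_right ip_unit_left mv_unit)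
qed

lemma bounded_below_imp_pos_def: "bounded_below n a A \<Longrightarrow> pos_def n A"
  unfolding bounded_below_def pos_def_def nsq_pos_iff[symmetric]
  by (meson less_le_trans mult_pos_pos)

text \<open>A kernel vector would make the quadratic form vanish, so the determinant is nonzero and
  \<open>mat_inverse\<close> succeeds. Both one-sided identities are recorded because uniqueness of
  solutions uses the left one.\<close>

lemma pos_def_mat_inverse:
  assumes "pos_def n A"
  obtains B where "mat_inverse (Matrix.mat n n (\<lambda>(r, c). A r c)) = Some B" "B \<in> carrier_mat n n"
    "Determinant.det (Matrix.mat n n (\<lambda>(r, c). A r c)) \<noteq> 0"
    "right_inverse n A (\<lambda>r c. B $$ (r, c))" "right_inverse n (\<lambda>r c. B $$ (r, c)) A"
proof -
  let ?A = "Matrix.mat n n (\<lambda>(r, c). A r c)"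
  have cA: "?A \<in> carrier_mat n n" by simp
  have det: "Determinant.det ?A \<noteq> 0"
  proof
    assume "Determinant.det ?A = 0"
    then obtain v where v: "v \<in> carrier_vec n" "v \<noteq> 0\<^sub>v n" "?A *\<^sub>v v = 0\<^sub>v n"
      using det_0_iff_vec_prod_zero[OF cA] by auto
    have "mv n A (vec_index v) r = 0" if "r < n" for r
    proof -
      have "vec_index (?A *\<^sub>v v) r = 0" using v(3) that by simp
      then show ?thesis using v(1) that
        by (simp add: scalar_prod_def mv_def lessThan_atLeast0)
    qed
    then have "ip n (mv n A (vec_index v)) (vec_index v) = 0" by (simp add: ip_def)
    moreover have "\<exists>i<n. vec_index v i \<noteq> 0" using v(1,2) by (metis carrier_vecD eq_vecI index_zero_vec)
    ultimately show False using assms unfolding pos_def_def by fastforce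
  qed
  then have "mat_inverse ?A \<noteq> None"
    using mat_inverse(1)[OF cA, of "()"] det_non_zero_imp_unit[OF cA det, of "()"] by blast
  then obtain B where B: "mat_inverse ?A = Some B" by auto
  from mat_inverse(2)[OF cA B] have *: "?A * B = 1\<^sub>m n" "B * ?A = 1\<^sub>m n" and cB: "B \<in> carrier_mat n n" by auto
  have "right_inverse n A (\<lambda>r c. B $$ (r, c))"
    unfolding right_inverse_def
  proof safe
    fix r c assume "r < n" "c < n"
    then show "(\<Sum>s<n. A r s * B $$ (s, c)) = (if r = c then 1 else 0)"
      using arg_cong[OF *(1), of "\<lambda>M. M $$ (r, c)"] cB
      by (simp add: scalar_prod_def lessThan_atLeast0)
  qed
  moreover have "right_inverse n (\<lambda>r c. B $$ (r, c)) A"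
    unfolding right_inverse_def
  proof safe
    fix r c assume "r < n" "c < n"
    then show "(\<Sum>s<n. B $$ (r, s) * A s c) = (if r = c then 1 else 0)"
      using arg_cong[OF *(2), of "\<lambda>M. M $$ (r, c)"] cB
      by (simp add: scalar_prod_def lessThan_atLeast0)
  qed
  ultimately show thesis using B cB det that by blast
qed

text \<open>The lower bound of A, evaluated at H x. With a = 1 it says that the squared norm of H x
  is at most the form of H at x, which later makes trace perturbations independent of the
  weights.\<close>

lemma ip_inverse_lower:
  assumes "bounded_below n a A" "right_inverse n A H"
  shows "a * nsq n (mv n H x) \<le> Re (ip n (mv n H x) x)"
proof -
  have "a * nsq n (mv n H x) \<le> Re (ip n (mv n A (mv n H x)) (mv n H x))"
    using assms(1) by (auto simp: bounded_below_def)
  also have "ip n (mv n A (mv n H x)) (mv n H x) = ip n x (mv n H x)"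
    using mv_right_inverse[OF assms(2)] by (intro ip_cong) auto
  also have "Re \<dots> = Re (ip n (mv n H x) x)"
    using cnj_ip[of n "mv n H x" x, symmetric] by simp
  finally show ?thesis .
qed

lemma norm_inverse_le:
  assumes "bounded_below n a A" "right_inverse n A H"
  shows "sqrt (nsq n (mv n H x)) \<le> sqrt (nsq n x) / a"
proof -
  let ?y = "sqrt (nsq n (mv n H x))"
  have a: "0 < a" using assms by (simp add: bounded_below_def)
  have "a * ?y * ?y \<le> Re (ip n (mv n H x) x)"
    using ip_inverse_lower[OF assms, of x] nsq_nonneg[of n "mv n H x"] by (simp add: mult.assoc)
  also have "\<dots> \<le> ?y * sqrt (nsq n x)"
    using complex_Re_le_cmod cauchy_schwarz order_trans by blast
  finally have le: "(a * ?y) * ?y \<le> sqrt (nsq n x) * ?y" by (simp add: mult.commute)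
  show ?thesis
  proof (cases "?y = 0")
    case True
    then show ?thesis using a nsq_nonneg by simp
  next
    case False
    then have "0 < ?y" using nsq_nonneg[of n "mv n H x"] by (simp add: less_le)
    then have "a * ?y \<le> sqrt (nsq n x)" using le mult_le_cancel_right_pos by blast
    then show ?thesis using a by (simp add: field_simps)
  qed
qed

lemma ip_inverse_upper:
  assumes "bounded_below n a A" "right_inverse n A H"
  shows "Re (ip n (mv n H x) x) \<le> nsq n x / a"
proof -
  have "Re (ip n (mv n H x) x) \<le> sqrt (nsq n (mv n H x)) * sqrt (nsq n x)"
    using complex_Re_le_cmod cauchy_schwarz order_trans by blast
  also have "\<dots> \<le> sqrt (nsq n x) / a * sqrt (nsq n x)"
    by (intro mult_right_mono norm_inverse_le[OF assms]) (simp add: nsq_nonneg)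
  also have "\<dots> = nsq n x / a" using nsq_nonneg[of n x] by simp
  finally show ?thesis .
qed

section \<open>Resolvent identity and the trace of a shifted inverse\<close>

lemma right_inverse_unique:
  assumes "right_inverse n A H" "right_inverse n H A" "\<And>i. i < n \<Longrightarrow> mv n A x i = y i" "r < n"
  shows "x r = mv n H y r"
  using mv_right_inverse[OF assms(2,4), of x] assms(3) by (simp add: mv_cong[of n "mv n A x" y])

text \<open>The resolvent identity (W - s I)^-1 = W^-1 + s W^-1 (W - s I)^-1: the vector y = H2 x
  solves W y = x + s y, and applying W^-1 gives the claim.\<close>

lemma resolvent_unit:
  assumes inv: "right_inverse n W H1" "right_inverse n H1 W"
    and inv2: "right_inverse n (\<lambda>r c. W r c - (if r = c then complex_of_real s else 0)) H2" and r: "r < n"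
  shows "mv n H2 x r = mv n H1 x r + complex_of_real s * mv n H1 (mv n H2 x) r"
proof -
  let ?y = "mv n H2 x"
  have "mv n W ?y i = x i + of_real s * ?y i" if "i < n" for i
  proof -
    have "x i = mv n (\<lambda>r c. W r c - (if r = c then complex_of_real s else 0)) ?y i"
      using mv_right_inverse[OF inv2 that] by simp
    also have "\<dots> = mv n W ?y i - (\<Sum>c<n. (if i = c then complex_of_real s else 0) * ?y c)"
      by (simp add: mv_def[of n _ "mv n H2 x"] left_diff_distrib sum_subtractf)
    also have "(\<Sum>c<n. (if i = c then complex_of_real s else 0) * ?y c) = (\<Sum>c<n. if i = c then of_real s * ?y c else 0)"
      by (intro sum.cong) auto
    also have "\<dots> = of_real s * ?y i" using that by simp
    finally show ?thesis by simp
  qed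
  from right_inverse_unique[OF inv this r] show ?thesis
    by (simp add: mv_add mv_scale)
qed

lemma trc_eq_ip: "trc n A = (\<Sum>r<n. ip n (mv n A (unit_fun r)) (unit_fun r))"
  by (simp add: trc_def ip_unit_right mv_unit)

text \<open>By the resolvent identity the traces differ by s times the trace of H1 H2. The norms of
  H1 and H2 are at most 1 and 2, so each of the n diagonal terms of that product is at most 2. This
  quadratic remainder in s becomes the variance term of the exponential moment.\<close>

lemma trc_resolvent:
  assumes W: "bounded_below n 1 W"
    and inv: "right_inverse n W H1" "right_inverse n H1 W"
    and inv2: "right_inverse n (\<lambda>r c. W r c - (if r = c then complex_of_real s else 0)) H2"
    and W2: "bounded_below n (1 / 2) (\<lambda>r c. W r c - (if r = c then complex_of_real s else 0))"
  shows "s * Re (trc n H2) \<le> s * Re (trc n H1) + 2 * s\<^sup>2 * n"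
proof -
  have h1: "herm n H1" using herm_right_inverse inv(1) W by (auto simp: bounded_below_def)
  define d where "d = (\<Sum>r<n. ip n (mv n H2 (unit_fun r)) (mv n H1 (unit_fun r)))"
  have "trc n H2 = (\<Sum>r<n. ip n (mv n H1 (unit_fun r)) (unit_fun r)
          + of_real s * ip n (mv n H1 (mv n H2 (unit_fun r))) (unit_fun r))"
    unfolding trc_eq_ip
    by (intro sum.cong refl) (simp add: ip_unit_right resolvent_unit[OF inv inv2])
  also have "\<dots> = trc n H1 + of_real s * d"
    by (simp add: sum.distrib trc_eq_ip d_def ip_mv_herm[OF h1] sum_distrib_left)
  finally have tr: "trc n H2 = trc n H1 + of_real s * d" .
  have "cmod d \<le> (\<Sum>r<n. 2)"
    unfolding d_def
  proof (intro sum_norm_le)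
    fix r assume "r \<in> {..<n}"
    then have r: "r < n" by simp
    have "cmod (ip n (mv n H2 (unit_fun r)) (mv n H1 (unit_fun r)))
        \<le> sqrt (nsq n (mv n H2 (unit_fun r))) * sqrt (nsq n (mv n H1 (unit_fun r)))"
      by (rule cauchy_schwarz)
    also have "\<dots> \<le> 2 * 1"
      using norm_inverse_le[OF W inv(1), of "unit_fun r"] norm_inverse_le[OF W2 inv2, of "unit_fun r"] r
      by (intro mult_mono) (auto simp: nsq_unit nsq_nonneg)
    finally show "cmod (ip n (mv n H2 (unit_fun r)) (mv n H1 (unit_fun r))) \<le> 2" by simp
  qed
  then have "Re d \<le> 2 * n" using complex_Re_le_cmod[of d] by simp
  then have "s\<^sup>2 * Re d \<le> s\<^sup>2 * (2 * n)" by (intro mult_left_mono) auto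
  moreover have "s * Re (trc n H2) = s * Re (trc n H1) + s\<^sup>2 * Re d"
    unfolding tr by (simp add: distrib_left power2_eq_square)
  ultimately show ?thesis by simp
qed

subsection \<open>A bound for the complex Gaussian integral\<close>

lemma measurable_coord:
  "i < n \<Longrightarrow> (\<lambda>z. z i) \<in> borel_measurable (complex_space n)"
  using measurable_component_singleton[of i "{..<n}" "\<lambda>_. lborel :: complex measure"] by simp

lemma measurable_quadratic_form:
  "(\<lambda>z. ip n (mv n G z) z) \<in> borel_measurable (complex_space n)"
  unfolding ip_def mv_def
  by (intro borel_measurable_sum borel_measurable_times borel_measurable_const
      borel_measurable_continuous_on[OF continuous_on_cnj[OF continuous_on_id]] measurable_coord) auto

text \<open>Completing the square exhibits the integrand as a multiple of the normal density with
  mean - b / g and variance 1 / (2 g).\<close>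

lemma nn_integral_real_gauss:
  fixes g b :: real
  assumes g: "0 < g"
  shows "(\<integral>\<^sup>+x. ennreal (exp (- g * x\<^sup>2 - 2 * b * x)) \<partial>lborel) = ennreal (sqrt (pi / g) * exp (b\<^sup>2 / g))"
proof -
  let ?\<sigma> = "sqrt (1 / (2 * g))"
  have \<sigma>: "0 < ?\<sigma>" using g by simp
  have "exp (- g * x\<^sup>2 - 2 * b * x) = sqrt (pi / g) * exp (b\<^sup>2 / g) * normal_density (- b / g) ?\<sigma> x" for x
  proof -
    have "2 * pi * ?\<sigma>\<^sup>2 = pi / g" "2 * ?\<sigma>\<^sup>2 = 1 / g" using g by (auto simp: field_simps)
    then have d: "normal_density (- b / g) ?\<sigma> x = 1 / sqrt (pi / g) * exp (- ((x + b / g)\<^sup>2 * g))"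
      unfolding normal_density_def by simp
    have "- g * x\<^sup>2 - 2 * b * x = b\<^sup>2 / g + - ((x + b / g)\<^sup>2 * g)"
      using g by (simp add: field_simps power2_eq_square)
    then have "exp (- g * x\<^sup>2 - 2 * b * x) = exp (b\<^sup>2 / g) * exp (- ((x + b / g)\<^sup>2 * g))"
      by (simp only: exp_add)
    then show ?thesis using g unfolding d by simp
  qed
  moreover have "(\<integral>\<^sup>+x. ennreal (normal_density (- b / g) ?\<sigma> x) \<partial>lborel) = 1"
    using integral_normal_density[OF \<sigma>] integrable_normal_density[OF \<sigma>]
    by (subst nn_integral_eq_integral) auto
  ultimately show ?thesis using g
    by (simp add: ennreal_mult' nn_integral_cmult)
qed

lemma measurable_complex_gauss:
  "(\<lambda>y. ennreal (exp (- g * (cmod y)\<^sup>2 - 2 * Re (cnj y * u)))) \<in> borel_measurable lborel"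
proof -
  have "(\<lambda>y. exp (- g * (cmod y)\<^sup>2 - 2 * Re (cnj y * u))) \<in> borel_measurable borel"
    by (intro borel_measurable_continuous_onI continuous_intros)
  then show ?thesis by simp
qed

text \<open>The exponent separates into real and imaginary parts, so the integral is a product of
  two real ones, indexed by \<open>Basis\<close>; \<open>inner u b\<close> is Re u or Im u.\<close>

lemma nn_integral_complex_gauss:
  fixes g :: real and u :: complex
  assumes g: "0 < g"
  shows "(\<integral>\<^sup>+y. ennreal (exp (- g * (cmod y)\<^sup>2 - 2 * Re (cnj y * u))) \<partial>lborel)
    = ennreal (pi / g * exp ((cmod u)\<^sup>2 / g))"
proof -
  define f where "f b x = exp (- g * x\<^sup>2 - 2 * (inner u b) * x)" for b :: complex and x :: real
  have "exp (- g * (cmod y)\<^sup>2 - 2 * Re (cnj y * u)) = (\<Prod>b\<in>Basis. f b (inner y b))" for y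
    by (simp add: Basis_complex_def f_def exp_add[symmetric] cmod_power2 algebra_simps)
  then have "(\<integral>\<^sup>+y. ennreal (exp (- g * (cmod y)\<^sup>2 - 2 * Re (cnj y * u))) \<partial>lborel)
      = (\<integral>\<^sup>+y. (\<Prod>b\<in>Basis. ennreal (f b (inner y b))) \<partial>lborel)"
    by (simp add: prod_ennreal f_def)
  also have "\<dots> = (\<Prod>b\<in>Basis. \<integral>\<^sup>+x. ennreal (f b x) \<partial>lborel)"
    by (intro nn_integral_lborel_prod) (auto simp: f_def)
  also have "\<dots> = (\<Prod>b\<in>Basis. ennreal (sqrt (pi / g) * exp ((inner u b)\<^sup>2 / g)))"
    unfolding f_def nn_integral_real_gauss[OF g] ..
  also have "\<dots> = ennreal (\<Prod>b\<in>Basis. sqrt (pi / g) * exp ((inner u b)\<^sup>2 / g))"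
    using g by (intro prod_ennreal) auto
  also have "(\<Prod>b\<in>Basis. sqrt (pi / g) * exp ((inner u b)\<^sup>2 / g)) = pi / g * exp ((cmod u)\<^sup>2 / g)"
  proof -
    have "(\<Prod>b\<in>Basis. sqrt (pi / g) * exp ((inner u b)\<^sup>2 / g))
        = (sqrt (pi / g))\<^sup>2 * (exp ((Re u)\<^sup>2 / g) * exp ((Im u)\<^sup>2 / g))"
      using g by (simp add: prod.distrib Basis_complex_def)
    also have "exp ((Re u)\<^sup>2 / g) * exp ((Im u)\<^sup>2 / g) = exp ((cmod u)\<^sup>2 / g)"
      by (simp add: cmod_power2 add_divide_distrib exp_add)
    finally show ?thesis using g by simp
  qed
  finally show ?thesis .
qed

text \<open>The Schur complement of the corner entry \<open>G n n\<close>. For positive definite G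
  its form is the minimum of the form of G over the last coordinate.\<close>

definition schur :: "nat \<Rightarrow> (nat \<Rightarrow> nat \<Rightarrow> complex) \<Rightarrow> nat \<Rightarrow> nat \<Rightarrow> complex" where
  "schur n G = (\<lambda>r s. G r s - G r n * G n s / G n n)"

text \<open>Isolates the dependence on the last coordinate so that it can be integrated out. Here
  \<open>mv n G z n\<close> is row n of G applied to the first n coordinates: \<open>mv\<close> does
  not restrict its row index.\<close>

lemma form_Suc:
  assumes "herm (Suc n) G"
  shows "Re (ip (Suc n) (mv (Suc n) G z) z)
    = Re (ip n (mv n G z) z) + 2 * Re (cnj (z n) * mv n G z n) + Re (G n n) * (cmod (z n))\<^sup>2"
proof -
  have h: "G r n = cnj (G n r)" if "r < n" for r
    using assms that unfolding herm_def by (meson lessI less_SucI)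
  have "ip (Suc n) (mv (Suc n) G z) z = ip n (mv n G z) z + (\<Sum>r<n. G r n * z n * cnj (z r))
      + mv n G z n * cnj (z n) + G n n * z n * cnj (z n)"
    by (simp add: ip_def mv_def algebra_simps sum.distrib)
  moreover have "(\<Sum>r<n. G r n * z n * cnj (z r)) = cnj (cnj (z n) * mv n G z n)"
    using h by (auto simp: mv_def sum_distrib_left algebra_simps intro!: sum.cong)
  moreover have "G n n * z n * cnj (z n) = G n n * of_real ((cmod (z n))\<^sup>2)"
    by (subst complex_norm_square) (simp add: mult.assoc)
  ultimately show ?thesis by (simp add: mult.commute[of "mv n G z n"] del: of_real_power)
qed

lemma form_schur:
  assumes h: "herm (Suc n) G"
  shows "Re (ip n (mv n (schur n G) z) z) = Re (ip n (mv n G z) z) - (cmod (mv n G z n))\<^sup>2 / Re (G n n)"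
proof -
  have hn: "G r n = cnj (G n r)" if "r < n" for r
    using h that unfolding herm_def by (meson lessI less_SucI)
  have "cnj (G n n) = G n n" using h unfolding herm_def by (metis lessI)
  then have gr: "G n n = of_real (Re (G n n))" by (simp add: complex_eq_iff)
  have "mv n (schur n G) z r = mv n G z r - G r n * mv n G z n / G n n" for r
    by (simp add: mv_def schur_def sum_subtractf sum_distrib_left sum_divide_distrib algebra_simps)
  then have "ip n (mv n (schur n G) z) z = ip n (\<lambda>r. mv n G z r - mv n G z n / G n n * G r n) z"
    by (intro ip_cong) auto
  also have "\<dots> = ip n (mv n G z) z - mv n G z n / G n n * (\<Sum>r<n. G r n * cnj (z r))"
    by (simp only: ip_diff_left ip_scale_left) (simp add: ip_def)
  also have "(\<Sum>r<n. G r n * cnj (z r)) = cnj (mv n G z n)"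
    using hn by (auto simp: mv_def intro!: sum.cong)
  also have "mv n G z n / G n n * cnj (mv n G z n) = of_real ((cmod (mv n G z n))\<^sup>2 / Re (G n n))"
    by (subst gr) (simp add: complex_norm_square del: of_real_power)
  finally show ?thesis by (simp del: of_real_power of_real_divide)
qed

lemma pos_def_diag:
  assumes "pos_def n A" "i < n"
  shows "0 < Re (A i i)"
proof -
  have "\<exists>j<n. unit_fun i j \<noteq> 0" using assms(2) by (auto simp: unit_fun_def)
  then have "0 < Re (ip n (mv n A (unit_fun i)) (unit_fun i))" using assms(1) by (auto simp: pos_def_def)
  then show ?thesis using assms(2) by (simp add: ip_unit_right mv_unit)
qed

lemma pos_def_schur:
  assumes G: "pos_def (Suc n) G"
  shows "pos_def n (schur n G)"
proof -
  have h: "herm (Suc n) G" using G by (simp add: pos_def_def)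
  have g: "0 < Re (G n n)" using pos_def_diag[OF G] by simp
  have sym: "cnj (G r s) = G s r" if "r < Suc n" "s < Suc n" for r s
    using h that unfolding herm_def by metis
  have "herm n (schur n G)"
    unfolding herm_def schur_def by (auto simp: sym)
  moreover have "0 < Re (ip n (mv n (schur n G) x) x)" if x: "\<exists>i<n. x i \<noteq> 0" for x
  proof -
    define u where "u = mv n G x n"
    \<comment> \<open>This last coordinate minimises the form of G, so the form of G at z equals the
      Schur form at x and positivity carries over.\<close>
    define z where "z = x(n := - u / of_real (Re (G n n)))"
    have zx: "ip n (mv n G z) z = ip n (mv n G x) x" "mv n G z n = u"
      using mv_cong[of n z x G] unfolding u_def z_def by (auto simp: ip_def)
    have "\<exists>i<Suc n. z i \<noteq> 0" using x by (auto simp: z_def)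
    then have "0 < Re (ip (Suc n) (mv (Suc n) G z) z)" using G by (auto simp: pos_def_def)
    also have "\<dots> = Re (ip n (mv n G x) x) + 2 * Re (cnj (z n) * u) + Re (G n n) * (cmod (z n))\<^sup>2"
      unfolding form_Suc[OF h] zx ..
    also have "cnj (z n) * u = - of_real ((cmod u)\<^sup>2 / Re (G n n))"
      by (simp add: z_def complex_norm_square mult.commute del: of_real_power)
    also have "Re (G n n) * (cmod (z n))\<^sup>2 = (cmod u)\<^sup>2 / Re (G n n)"
      using g by (simp add: z_def norm_divide power_divide power2_eq_square)
    finally show ?thesis unfolding form_schur[OF h] u_def[symmetric] by (simp del: of_real_power of_real_divide)
  qed
  ultimately show ?thesis by (simp add: pos_def_def)
qed

text \<open>The leading block of the inverse of G inverts the Schur complement: row n of G H = I, in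
  a column c < n, has right-hand side 0 and expresses \<open>H n c\<close> through the other
  entries. Hence H stays the same throughout the induction on the dimension.\<close>

lemma right_inverse_schur:
  assumes inv: "right_inverse (Suc n) G H" and g: "G n n \<noteq> 0"
  shows "right_inverse n (schur n G) H"
  unfolding right_inverse_def
proof safe
  fix r c assume rc: "r < n" "c < n"
  have e: "(\<Sum>s<n. G r s * H s c) + G r n * H n c = (if r = c then 1 else 0)" if "r < Suc n" for r
    using inv rc that unfolding right_inverse_def by (auto simp: less_Suc_eq)
  have "(\<Sum>s<n. G n s * H s c) + G n n * H n c = 0" using e[of n] rc by simp
  then have n: "H n c = - (\<Sum>s<n. G n s * H s c) / G n n"
    using g by (simp add: field_simps add_eq_0_iff)
  have "(\<Sum>s<n. schur n G r s * H s c) = (\<Sum>s<n. G r s * H s c) - G r n * (\<Sum>s<n. G n s * H s c) / G n n"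
    by (simp add: schur_def sum_subtractf sum_distrib_left sum_divide_distrib algebra_simps)
  also have "\<dots> = (\<Sum>s<n. G r s * H s c) + G r n * H n c" by (simp add: n)
  also have "\<dots> = (if r = c then 1 else 0)" using e[of r] rc by simp
  finally show "(\<Sum>s<n. schur n G r s * H s c) = (if r = c then 1 else 0)" .
qed

text \<open>With y = H e_i and c = 1 / G_ii, the form of G at y - c e_i is nonnegative and expands
  to exactly H_ii - 1 / G_ii. This lets a pivot be replaced by a diagonal entry of the
  inverse.\<close>

lemma inverse_diag_le:
  assumes G: "pos_def n G" and inv: "right_inverse n G H" and i: "i < n"
  shows "1 / Re (G i i) \<le> Re (H i i)"
proof -
  have g: "0 < Re (G i i)" using pos_def_diag[OF G i] .
  have h: "herm n G" using G by (simp add: pos_def_def)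
  define y where "y = mv n H (unit_fun i)"
  define c where "c = complex_of_real (1 / Re (G i i))"
  define x where "x = (\<lambda>j. y j - c * unit_fun i j)"
  have nn: "0 \<le> Re (ip n (mv n G x) x)"
    using G unfolding pos_def_def by (cases "\<exists>i<n. x i \<noteq> 0") (auto simp: ip_def less_imp_le)
  have Gy: "mv n G y j = unit_fun i j" if "j < n" for j
    unfolding y_def by (rule mv_right_inverse[OF inv that])
  define v where "v = mv n G (unit_fun i)"
  have yi: "y i = H i i" and vi: "v i = G i i" using i by (simp_all add: y_def v_def mv_unit)
  have "ip n v y = ip n (unit_fun i) (unit_fun i)"
    unfolding v_def ip_mv_herm[OF h] using Gy by (intro ip_cong) auto
  then have vy: "ip n v y = 1" using i by (simp add: ip_self nsq_unit)
  have "ip n (mv n G x) x = ip n (\<lambda>j. unit_fun i j - c * v j) x"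
    by (intro ip_cong refl) (simp add: x_def mv_diff mv_scale Gy v_def)
  also have "\<dots> = cnj (H i i) - cnj c - c + c * cnj c * G i i"
    using i unfolding x_def
    by (simp only: ip_diff_left ip_diff_right ip_scale_left ip_scale_right vy)
       (simp add: ip_unit_left ip_unit_right ip_self nsq_unit yi vi algebra_simps)
  finally have "Re (ip n (mv n G x) x) = Re (H i i) - 1 / Re (G i i)"
    using g by (simp add: c_def power2_eq_square)
  then show ?thesis using nn by simp
qed

text \<open>The integral equals \<open>pi ^ n / det G\<close>. Integrating out the last coordinate replaces G by a Schur
  complement, so that bounding each pivot g by \<open>a / g \<le> exp (a / g - 1)\<close> gives a trace instead of
  the determinant.\<close>

lemma nn_integral_gauss_le:
  assumes "pos_def n G" "right_inverse n G H" and a: "0 < a"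
  shows "(\<integral>\<^sup>+z. ennreal (exp (- Re (ip n (mv n G z) z))) \<partial>complex_space n)
    \<le> ennreal ((pi / a) ^ n * exp (a * Re (trc n H) - n))"
  using assms(1,2)
proof (induction n arbitrary: G)
  case 0
  interpret product_sigma_finite "\<lambda>_. lborel :: complex measure" by standard
  show ?case
    by (simp add: ip_def trc_def space_PiM_empty)
next
  case (Suc n)
  interpret product_sigma_finite "\<lambda>_. lborel :: complex measure" by standard
  have h: "herm (Suc n) G" using Suc.prems by (simp add: pos_def_def)
  have g: "0 < Re (G n n)" using pos_def_diag[OF Suc.prems(1)] by simp
  let ?g = "Re (G n n)"
  have ins: "{..<Suc n} = insert n {..<n}" by auto
  have "(\<integral>\<^sup>+z. ennreal (exp (- Re (ip (Suc n) (mv (Suc n) G z) z))) \<partial>complex_space (Suc n))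
    = (\<integral>\<^sup>+z. (\<integral>\<^sup>+y. ennreal (exp (- Re (ip (Suc n) (mv (Suc n) G (z(n := y))) (z(n := y))))) \<partial>lborel) \<partial>complex_space n)"
    unfolding ins
  proof (rule product_nn_integral_insert)
    show "(\<lambda>z. ennreal (exp (- Re (ip (Suc n) (mv (Suc n) G z) z)))) \<in> borel_measurable (Pi\<^sub>M (insert n {..<n}) (\<lambda>_. lborel))"
      using measurable_quadratic_form[of "Suc n" G] unfolding ins by measurable
  qed auto
  also have "\<dots> = (\<integral>\<^sup>+z. ennreal (exp (- Re (ip n (mv n (schur n G) z) z)) * (pi / ?g)) \<partial>complex_space n)"
  proof (intro nn_integral_cong)
    fix z :: "nat \<Rightarrow> complex"
    have "ennreal (exp (- Re (ip (Suc n) (mv (Suc n) G (z(n := y))) (z(n := y)))))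
       = ennreal (exp (- Re (ip n (mv n G z) z))) * ennreal (exp (- ?g * (cmod y)\<^sup>2 - 2 * Re (cnj y * mv n G z n)))" for y
    proof -
      have "ip n (mv n G (z(n := y))) (z(n := y)) = ip n (mv n G z) z" "mv n G (z(n := y)) n = mv n G z n"
        using mv_cong[of n "z(n := y)" z G] by (auto simp: ip_def)
      then show ?thesis
        unfolding form_Suc[OF h] by (simp add: ennreal_mult[symmetric] exp_add[symmetric])
    qed
    then have "(\<integral>\<^sup>+y. ennreal (exp (- Re (ip (Suc n) (mv (Suc n) G (z(n := y))) (z(n := y))))) \<partial>lborel)
       = ennreal (exp (- Re (ip n (mv n G z) z))) * ennreal (pi / ?g * exp ((cmod (mv n G z n))\<^sup>2 / ?g))"
      unfolding nn_integral_complex_gauss[OF g, symmetric]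
      by (simp only:) (intro nn_integral_cmult measurable_complex_gauss)
    also have "\<dots> = ennreal (exp (- Re (ip n (mv n G z) z)) * (pi / ?g * exp ((cmod (mv n G z n))\<^sup>2 / ?g)))"
      using g by (intro ennreal_mult[symmetric]) auto
    also have "\<dots> = ennreal (exp (- Re (ip n (mv n (schur n G) z) z)) * (pi / ?g))"
      unfolding form_schur[OF h] by (simp add: exp_diff exp_minus field_simps)
    finally show "(\<integral>\<^sup>+y. ennreal (exp (- Re (ip (Suc n) (mv (Suc n) G (z(n := y))) (z(n := y))))) \<partial>lborel)
       = ennreal (exp (- Re (ip n (mv n (schur n G) z) z)) * (pi / ?g))" .
  qed
  also have "\<dots> = (\<integral>\<^sup>+z. ennreal (exp (- Re (ip n (mv n (schur n G) z) z))) \<partial>complex_space n) * ennreal (pi / ?g)"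
  proof -
    have "(\<lambda>z. ennreal (exp (- Re (ip n (mv n (schur n G) z) z)))) \<in> borel_measurable (complex_space n)"
      using measurable_quadratic_form[of n "schur n G"] by measurable
    from nn_integral_multc[OF this, of "ennreal (pi / ?g)"] show ?thesis
      using g by (simp only: ennreal_mult[symmetric] exp_ge_zero divide_nonneg_pos pi_ge_zero)
  qed
  also have "\<dots> \<le> ennreal ((pi / a) ^ n * exp (a * Re (trc n H) - n)) * ennreal (pi / ?g)"
    using g by (intro mult_right_mono Suc.IH pos_def_schur[OF Suc.prems(1)] right_inverse_schur[OF Suc.prems(2)]) auto
  also have "\<dots> = ennreal ((pi / a) ^ n * exp (a * Re (trc n H) - n) * (pi / ?g))"
    using g a by (intro ennreal_mult[symmetric]) auto
  also have "\<dots> \<le> ennreal ((pi / a) ^ Suc n * exp (a * Re (trc (Suc n) H) - Suc n))"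
  proof (intro ennreal_leI)
    have "a / ?g \<le> exp (a / ?g - 1)" using exp_ge_add_one_self[of "a / ?g - 1"] by simp
    also have "\<dots> \<le> exp (a * Re (H n n) - 1)"
      using mult_left_mono[OF inverse_diag_le[OF Suc.prems, of n], of a] a by simp
    finally have "pi / a * (a / ?g) \<le> pi / a * exp (a * Re (H n n) - 1)"
      using a by (intro mult_left_mono) auto
    then have "pi / ?g \<le> pi / a * exp (a * Re (H n n) - 1)" using a by simp
    then have "(pi / a) ^ n * exp (a * Re (trc n H) - n) * (pi / ?g)
       \<le> (pi / a) ^ n * exp (a * Re (trc n H) - n) * (pi / a * exp (a * Re (H n n) - 1))"
      using a by (intro mult_left_mono) auto
    also have "\<dots> = (pi / a) ^ Suc n * (exp (a * Re (trc n H) - n) * exp (a * Re (H n n) - 1))"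
      by simp
    also have "\<dots> = (pi / a) ^ Suc n * exp (a * Re (trc (Suc n) H) - Suc n)"
      unfolding exp_add[symmetric] by (simp add: trc_def algebra_simps)
    finally show "(pi / a) ^ n * exp (a * Re (trc n H) - n) * (pi / ?g)
       \<le> (pi / a) ^ Suc n * exp (a * Re (trc (Suc n) H) - Suc n)" .
  qed
  finally show ?case .
qed

subsection \<open>Gram matrices and the exponential moments of quadratic forms\<close>

definition minv :: "nat \<Rightarrow> (nat \<Rightarrow> nat \<Rightarrow> complex) \<Rightarrow> nat \<Rightarrow> nat \<Rightarrow> complex" where
  "minv n A = (\<lambda>r c. the (mat_inverse (Matrix.mat n n (\<lambda>(r, c). A r c))) $$ (r, c))"

lemma minv_inverse:
  assumes "pos_def n A"
  shows "right_inverse n A (minv n A)" "right_inverse n (minv n A) A"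
  using pos_def_mat_inverse[OF assms] unfolding minv_def by (metis option.sel)+

lemma inv_form_eq:
  assumes "pos_def n A"
  shows "inv_form n (Matrix.mat n n (\<lambda>(r, c). A r c)) z = Re (ip n (mv n (minv n A) z) z)"
proof -
  obtain B where B: "mat_inverse (Matrix.mat n n (\<lambda>(r, c). A r c)) = Some B" "B \<in> carrier_mat n n"
    using pos_def_mat_inverse[OF assms] by metis
  have "minv n A = (\<lambda>r c. B $$ (r, c))" by (simp add: minv_def B)
  then show ?thesis using B
    by (simp add: inv_form_def scalar_prod_def ip_def mv_def lessThan_atLeast0)
qed

text \<open>Cramer's rule, from B A adj(A) = det(A) B. It is needed for measurability:
  \<open>mat_inverse\<close> is defined by an elimination procedure, whereas cofactors and
  determinants are polynomials in the entries.\<close>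

lemma minv_adj_mat:
  assumes "pos_def n A" "r < n" "c < n"
  shows "minv n A r c = cofactor (Matrix.mat n n (\<lambda>(r, c). A r c)) c r / Determinant.det (Matrix.mat n n (\<lambda>(r, c). A r c))"
proof -
  let ?A = "Matrix.mat n n (\<lambda>(r, c). A r c)"
  have cA: "?A \<in> carrier_mat n n" by simp
  obtain B where B: "mat_inverse ?A = Some B" "B \<in> carrier_mat n n" and d: "Determinant.det ?A \<noteq> 0"
    using pos_def_mat_inverse[OF assms(1)] by metis
  have BA: "B * ?A = 1\<^sub>m n" using mat_inverse(2)[OF cA B(1)] by simp
  have "adj_mat ?A = (B * ?A) * adj_mat ?A" using BA adj_mat(1)[OF cA] by simp
  also have "\<dots> = B * (Determinant.det ?A \<cdot>\<^sub>m 1\<^sub>m n)"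
    using assoc_mult_mat[OF B(2) cA adj_mat(1)[OF cA]] adj_mat(2)[OF cA] by simp
  also have "\<dots> = Determinant.det ?A \<cdot>\<^sub>m B" using mult_smult_distrib[OF B(2) one_carrier_mat] B(2) by simp
  finally have "adj_mat ?A $$ (r, c) = Determinant.det ?A * B $$ (r, c)" using B(2) assms by simp
  moreover have "adj_mat ?A $$ (r, c) = cofactor ?A c r" using assms by (simp add: adj_mat_def)
  ultimately show ?thesis using d by (simp add: minv_def B(1) field_simps)
qed

lemma measurable_det:
  fixes f :: "nat \<Rightarrow> nat \<Rightarrow> 'p \<Rightarrow> complex"
  assumes "\<And>r c. r < n \<Longrightarrow> c < n \<Longrightarrow> f r c \<in> borel_measurable P"
  shows "(\<lambda>x. Determinant.det (Matrix.mat n n (\<lambda>(r, c). f r c x))) \<in> borel_measurable P"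
proof -
  have permutes_less: "p i < n" if "p permutes {0..<n}" "i < n" for p i
    using permutes_in_image[OF that(1), of i] that(2) by simp
  have "(\<lambda>x. Determinant.det (Matrix.mat n n (\<lambda>(r, c). f r c x)))
    = (\<lambda>x. \<Sum>p | p permutes {0..<n}. signof p * (\<Prod>i = 0..<n. f i (p i) x))"
    by (auto simp: Determinant.det_def fun_eq_iff permutes_less intro!: sum.cong prod.cong)
  note det_eq = this
  show ?thesis
    unfolding det_eq
  proof (intro borel_measurable_sum borel_measurable_times borel_measurable_const borel_measurable_prod)
    fix p i assume "p \<in> {p. p permutes {0..<n}}" "i \<in> {0..<n}"
    then show "f i (p i) \<in> borel_measurable P" using assms permutes_less by auto
  qed
qed

lemma measurable_minv:
  assumes f: "\<And>r c. r < n \<Longrightarrow> c < n \<Longrightarrow> f r c \<in> borel_measurable P"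
    and pd: "\<And>x. x \<in> space P \<Longrightarrow> pos_def n (\<lambda>r c. f r c x)" and rc: "r < n" "c < n"
  shows "(\<lambda>x. minv n (\<lambda>r c. f r c x) r c) \<in> borel_measurable P"
proof -
  \<comment> \<open>The index shift of a deleted row or column: it enumerates all indices except
    i.\<close>
  let ?d = "\<lambda>i i'. if i' < i then i' else Suc i'"
  have "(\<lambda>x. cofactor (Matrix.mat n n (\<lambda>(r, c). f r c x)) c r) \<in> borel_measurable P"
  proof -
    have "(\<lambda>x. cofactor (Matrix.mat n n (\<lambda>(r, c). f r c x)) c r)
      = (\<lambda>x. (-1) ^ (c + r) * Determinant.det (Matrix.mat (n - 1) (n - 1) (\<lambda>(i, j). f (?d c i) (?d r j) x)))"
      using rc by (auto simp: cofactor_def mat_delete_def fun_eq_iff intro!: arg_cong[of _ _ Determinant.det])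
    then show ?thesis
      using rc by (auto intro!: borel_measurable_times measurable_det f)
  qed
  then have "(\<lambda>x. cofactor (Matrix.mat n n (\<lambda>(r, c). f r c x)) c r / Determinant.det (Matrix.mat n n (\<lambda>(r, c). f r c x)))
      \<in> borel_measurable P"
    by (intro borel_measurable_divide measurable_det f) auto
  then show ?thesis
    by (rule measurable_cong[THEN iffD1, rotated]) (simp add: minv_adj_mat[OF pd rc])
qed

text \<open>For covariance I / n the inverse is n I and the determinant is n^-n, which leaves an
  explicit function of the squared norm.\<close>

lemma complex_normal_density_scaled:
  assumes n: "0 < n"
  shows "complex_normal_density n (complex_of_real (1 / real n) \<cdot>\<^sub>m 1\<^sub>m n) z
    = (real n / pi) ^ n * exp (- real n * nsq n z)"
proof -
  define A where "A = (\<lambda>r c :: nat. if r = c then complex_of_real (1 / real n) else 0 :: complex)"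
  have M: "complex_of_real (1 / real n) \<cdot>\<^sub>m 1\<^sub>m n = Matrix.mat n n (\<lambda>(r, c). A r c)"
    by (rule eq_matI) (auto simp: A_def)
  have mvA: "mv n A x r = complex_of_real (1 / real n) * x r" if "r < n" for x r
    using that by (simp add: mv_def A_def mult_delta_left)
  have "herm n A" by (auto simp: herm_def A_def)
  moreover have "0 < Re (ip n (mv n A x) x)" if "\<exists>i<n. x i \<noteq> 0" for x
  proof -
    have "ip n (mv n A x) x = ip n (\<lambda>r. complex_of_real (1 / real n) * x r) x"
      by (intro ip_cong) (auto simp: mvA)
    also have "\<dots> = complex_of_real (nsq n x / real n)" by (simp only: ip_scale_left ip_self) simp
    finally show ?thesis using n that by (simp add: nsq_pos_iff)
  qed
  ultimately have pd: "pos_def n A" by (simp add: pos_def_def)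
  have "mv n (minv n A) z r = of_nat n * z r" if r: "r < n" for r
    using mv_right_inverse[OF minv_inverse(1)[OF pd] r, of z] mvA[OF r] n by (simp add: field_simps)
  then have "ip n (mv n (minv n A) z) z = ip n (\<lambda>r. of_nat n * z r) z"
    by (intro ip_cong) auto
  also have "\<dots> = complex_of_real (real n * nsq n z)" by (simp add: ip_scale_left ip_self)
  finally have "inv_form n (Matrix.mat n n (\<lambda>(r, c). A r c)) z = real n * nsq n z"
    by (simp add: inv_form_eq[OF pd])
  moreover have "Determinant.det (complex_of_real (1 / real n) \<cdot>\<^sub>m 1\<^sub>m n) = complex_of_real ((1 / real n) ^ n)"
    by (simp add: det_smult)
  ultimately show ?thesis
    unfolding complex_normal_density_def M[symmetric] by (simp add: exp_minus field_simps power_divide)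
qed

definition gram :: "('s \<Rightarrow> real) \<Rightarrow> 's set \<Rightarrow> ('s \<Rightarrow> nat \<Rightarrow> complex) \<Rightarrow> nat \<Rightarrow> nat \<Rightarrow> complex" where
  "gram c J \<psi> = (\<lambda>r s. (if r = s then 1 else 0) + (\<Sum>j\<in>J. complex_of_real (c j) * (\<psi> j r * cnj (\<psi> j s))))"

lemma Z_mat_eq: "Z_mat t Ep b J \<psi> = Matrix.mat t t (\<lambda>(r, s). gram (\<lambda>j. Ep * b j) J \<psi> r s)"
  by (rule eq_matI) (auto simp: Z_mat_def gram_def)

lemma mv_gram:
  assumes r: "r < n"
  shows "mv n (gram c J \<psi>) x r = x r + (\<Sum>j\<in>J. complex_of_real (c j) * ip n x (\<psi> j) * \<psi> j r)"
proof -
  have "mv n (gram c J \<psi>) x r = (\<Sum>s<n. (if r = s then 1 else 0) * x s)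
      + (\<Sum>s<n. \<Sum>j\<in>J. complex_of_real (c j) * (\<psi> j r * cnj (\<psi> j s)) * x s)"
    by (simp add: mv_def gram_def distrib_right sum.distrib sum_distrib_right)
  also have "(\<Sum>s<n. (if r = s then 1 else 0) * x s) = x r" using r by (simp add: mult_delta_left)
  also have "(\<Sum>s<n. \<Sum>j\<in>J. complex_of_real (c j) * (\<psi> j r * cnj (\<psi> j s)) * x s)
      = (\<Sum>j\<in>J. complex_of_real (c j) * ip n x (\<psi> j) * \<psi> j r)"
    by (subst sum.swap) (simp add: ip_def sum_distrib_left sum_distrib_right algebra_simps)
  finally show ?thesis .
qed

text \<open>Each rank-one summand contributes c j times a squared modulus to the form, so only the
  identity part is kept. The constant 1 depends on neither the weights nor the pilots.\<close>

lemma gram_bounded_below: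
  assumes c: "\<And>j. j \<in> J \<Longrightarrow> 0 < c j"
  shows "bounded_below n 1 (gram c J \<psi>)"
proof -
  have "herm n (gram c J \<psi>)"
    by (auto simp: herm_def gram_def mult.commute)
  moreover have "nsq n x \<le> Re (ip n (mv n (gram c J \<psi>) x) x)" for x
  proof -
    have "ip n (mv n (gram c J \<psi>) x) x = ip n (\<lambda>r. x r + (\<Sum>j\<in>J. complex_of_real (c j) * ip n x (\<psi> j) * \<psi> j r)) x"
      by (intro ip_cong) (simp_all add: mv_gram)
    also have "\<dots> = nsq n x + (\<Sum>j\<in>J. complex_of_real (c j) * ip n x (\<psi> j) * ip n (\<psi> j) x)"
    proof -
      have "ip n (\<lambda>r. \<Sum>j\<in>J. complex_of_real (c j) * ip n x (\<psi> j) * \<psi> j r) x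
        = (\<Sum>j\<in>J. complex_of_real (c j) * ip n x (\<psi> j) * ip n (\<psi> j) x)"
        unfolding ip_def[of n _ x] sum_distrib_right sum_distrib_left
        by (subst sum.swap) (simp add: mult.assoc)
      then show ?thesis by (simp add: ip_add_left ip_self)
    qed
    also have "(\<Sum>j\<in>J. complex_of_real (c j) * ip n x (\<psi> j) * ip n (\<psi> j) x)
        = of_real (\<Sum>j\<in>J. c j * (cmod (ip n x (\<psi> j)))\<^sup>2)"
      unfolding of_real_sum of_real_mult complex_norm_square cnj_ip by (simp add: mult.assoc)
    finally show ?thesis
      using c by (auto intro!: sum_nonneg simp del: of_real_sum of_real_power simp: less_imp_le)
  qed
  ultimately show ?thesis by (simp add: bounded_below_def)
qed

text \<open>Multiplying the Gaussian density by the exponential gives a Gaussian integrand with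
  matrix G = n (I - s W^-1), whose inverse is (1/n) (I + s (W - s I)^-1). The trace bound for such
  integrals yields exp (s Tr (W - s I)^-1); centring removes s Tr W^-1, and
  \<open>trc_resolvent\<close> bounds what remains.\<close>

lemma gauss_mgf_le:
  assumes W: "bounded_below n 1 W" and n: "0 < n" and s: "\<bar>s\<bar> \<le> 1 / 2"
  shows "(\<integral>\<^sup>+z. ennreal (exp (s * (n * Re (ip n (mv n (minv n W) z) z) - Re (trc n (minv n W)))))
      \<partial>density (complex_space n) (\<lambda>z. (real n / pi) ^ n * exp (- real n * nsq n z)))
    \<le> ennreal (exp (2 * s\<^sup>2 * n))"
proof -
  define H1 where "H1 = minv n W"
  define W2 where "W2 = (\<lambda>r c. W r c - (if r = c then complex_of_real s else 0))"
  have inv1: "right_inverse n W H1" "right_inverse n H1 W"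
    unfolding H1_def using minv_inverse bounded_below_imp_pos_def[OF W] by blast+
  have hW: "herm n W" using W by (simp add: bounded_below_def)
  have hH: "herm n H1" using herm_right_inverse[OF hW inv1(1)] .
  have sH: "cnj (H1 r c) = H1 c r" if "r < n" "c < n" for r c
    using hH that unfolding herm_def by metis
  have sW: "cnj (W r c) = W c r" if "r < n" "c < n" for r c
    using hW that unfolding herm_def by metis
  have mvI: "mv n (\<lambda>r c. A r c + (if r = c then k else 0)) x r = mv n A x r + k * x r" if "r < n" for A x r k
    using that by (simp add: mv_def distrib_right sum.distrib mult_delta_left)
  have mvW2: "mv n W2 x r = mv n W x r - of_real s * x r" if "r < n" for x r
    using that by (simp add: W2_def mv_def left_diff_distrib sum_subtractf mult_delta_left)
  \<comment> \<open>Since \<bar>s\<bar> \<le> 1/2, the shift consumes at most half of the lower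
    bound 1.\<close>
  have W2: "bounded_below n (1 / 2) W2"
    unfolding bounded_below_def
  proof (intro conjI allI)
    show "herm n W2" unfolding herm_def W2_def by (auto simp: sW)
    fix x
    have "ip n (mv n W2 x) x = ip n (\<lambda>r. mv n W x r - of_real s * x r) x"
      by (intro ip_cong) (auto simp: mvW2)
    then have "Re (ip n (mv n W2 x) x) = Re (ip n (mv n W x) x) - s * nsq n x"
      by (simp add: ip_diff_left ip_scale_left ip_self)
    moreover have "nsq n x \<le> Re (ip n (mv n W x) x)" using W by (simp add: bounded_below_def)
    moreover have "s * nsq n x \<le> 1 / 2 * nsq n x"
      using s nsq_nonneg[of n x] by (intro mult_right_mono) auto
    ultimately show "1 / 2 * nsq n x \<le> Re (ip n (mv n W2 x) x)" by simp
  qed simp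
  define H2 where "H2 = minv n W2"
  have inv2: "right_inverse n W2 H2"
    unfolding H2_def using minv_inverse(1) bounded_below_imp_pos_def[OF W2] by blast
  define G where "G = (\<lambda>r c. - (complex_of_real (n * s) * H1 r c) + (if r = c then of_nat n else 0))"
  \<comment> \<open>The candidate comes from (I - s W^-1)^-1 = W (W - s I)^-1 = I + s (W - s
    I)^-1.\<close>
  define HG where "HG = (\<lambda>r c. complex_of_real (s / n) * H2 r c + (if r = c then complex_of_real (1 / n) else 0))"
  have mvc: "mv n (\<lambda>r c. k * A r c) x r = k * mv n A x r" for k A x r
    by (simp add: mv_def sum_distrib_left mult.assoc)
  have mvG: "mv n G x r = of_nat n * (x r - of_real s * mv n H1 x r)" if "r < n" for x r
  proof -
    have "mv n G x r = - (complex_of_real (n * s)) * mv n H1 x r + of_nat n * x r"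
      unfolding G_def mvI[OF that] mult_minus_left[symmetric] mvc ..
    then show ?thesis by (simp add: algebra_simps)
  qed
  have mvHG: "mv n HG x r = of_real (1 / n) * (x r + of_real s * mv n H2 x r)" if "r < n" for x r
    unfolding HG_def mvI[OF that] mvc using n by (simp add: field_simps)
  have invG: "right_inverse n G HG"
  proof (rule right_inverseI)
    fix r c assume r: "r < n"
    let ?x = "unit_fun c"
    have "mv n G (mv n HG ?x) r = of_nat n * (mv n HG ?x r - of_real s * mv n H1 (mv n HG ?x) r)"
      by (rule mvG[OF r])
    also have "mv n H1 (mv n HG ?x) r = mv n H1 (\<lambda>i. of_real (1 / n) * (?x i + of_real s * mv n H2 ?x i)) r"
      by (intro fun_cong[OF mv_cong] mvHG)
    also have "\<dots> = of_real (1 / n) * (mv n H1 ?x r + of_real s * mv n H1 (mv n H2 ?x) r)"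
      by (simp only: mv_scale mv_add)
    also have "\<dots> = of_real (1 / n) * mv n H2 ?x r"
      using resolvent_unit[OF inv1 inv2[unfolded W2_def] r] by simp
    also have "of_nat n * (mv n HG ?x r - of_real s * (of_real (1 / n) * mv n H2 ?x r)) = ?x r"
      unfolding mvHG[OF r] using n by (simp add: field_simps)
    finally show "mv n G (mv n HG ?x) r = ?x r" .
  qed
  have form: "Re (ip n (mv n G x) x) = n * (nsq n x - s * Re (ip n (mv n H1 x) x))" for x
  proof -
    have "ip n (mv n G x) x = ip n (\<lambda>r. of_nat n * (x r - of_real s * mv n H1 x r)) x"
      by (intro ip_cong) (auto simp: mvG)
    then show ?thesis by (simp add: ip_diff_left ip_scale_left ip_self)
  qed
  have pdG: "pos_def n G"
    unfolding pos_def_def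
  proof (intro conjI allI impI)
    show "herm n G" unfolding herm_def G_def by (auto simp: sH)
    fix x :: "nat \<Rightarrow> complex" assume "\<exists>i<n. x i \<noteq> 0"
    then have x: "0 < nsq n x" by (simp add: nsq_pos_iff)
    have q: "0 \<le> Re (ip n (mv n H1 x) x)" "Re (ip n (mv n H1 x) x) \<le> nsq n x"
      using ip_inverse_lower[OF W inv1(1), of x] nsq_nonneg[of n "mv n H1 x"]
        ip_inverse_upper[OF W inv1(1), of x] by auto
    have "s * Re (ip n (mv n H1 x) x) \<le> 1 / 2 * nsq n x"
      using s q by (intro mult_mono) auto
    then show "0 < Re (ip n (mv n G x) x)" unfolding form using x n by simp
  qed
  have tr: "n * Re (trc n HG) - n = s * Re (trc n H2)"
  proof -
    have "trc n HG = complex_of_real (s / n) * trc n H2 + 1"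
      using n by (simp add: trc_def HG_def sum.distrib sum_distrib_left)
    then have "Re (trc n HG) = s / n * Re (trc n H2) + 1" by simp
    then show ?thesis using n by (simp add: field_simps)
  qed
  have meas: "(\<lambda>z. nsq n z) \<in> borel_measurable (complex_space n)"
    unfolding nsq_def by (intro borel_measurable_sum borel_measurable_power borel_measurable_norm measurable_coord) auto
  let ?k = "(real n / pi) ^ n * exp (- s * Re (trc n H1))"
  have "(\<integral>\<^sup>+z. ennreal (exp (s * (n * Re (ip n (mv n H1 z) z) - Re (trc n H1))))
      \<partial>density (complex_space n) (\<lambda>z. (real n / pi) ^ n * exp (- real n * nsq n z)))
    = (\<integral>\<^sup>+z. ennreal ((real n / pi) ^ n * exp (- real n * nsq n z))
        * ennreal (exp (s * (n * Re (ip n (mv n H1 z) z) - Re (trc n H1)))) \<partial>complex_space n)"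
  proof (rule nn_integral_density)
    have 1: "(\<lambda>x. ennreal (k * exp (d * f x))) \<in> borel_measurable P"
      if "f \<in> borel_measurable P" for k d :: real and f and P :: "(nat \<Rightarrow> complex) measure"
      using that by measurable
    have 2: "(\<lambda>x. ennreal (exp (s * (d * Re (f x) - e)))) \<in> borel_measurable P"
      if "f \<in> borel_measurable P" for d e and f and P :: "(nat \<Rightarrow> complex) measure"
      using that by measurable
    show "(\<lambda>z. ennreal ((real n / pi) ^ n * exp (- real n * nsq n z))) \<in> borel_measurable (complex_space n)"
      by (rule 1[OF meas])
    show "(\<lambda>z. ennreal (exp (s * (n * Re (ip n (mv n H1 z) z) - Re (trc n H1))))) \<in> borel_measurable (complex_space n)"
      by (rule 2[OF measurable_quadratic_form])
  qed
  also have "\<dots> = (\<integral>\<^sup>+z. ennreal ?k * ennreal (exp (- Re (ip n (mv n G z) z))) \<partial>complex_space n)"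
  proof (intro nn_integral_cong)
    fix z
    have "exp (- real n * nsq n z) * exp (s * (n * Re (ip n (mv n H1 z) z) - Re (trc n H1)))
       = exp (- s * Re (trc n H1)) * exp (- Re (ip n (mv n G z) z))"
      unfolding exp_add[symmetric] form by (simp add: algebra_simps)
    then have "(real n / pi) ^ n * exp (- real n * nsq n z) * exp (s * (n * Re (ip n (mv n H1 z) z) - Re (trc n H1)))
       = ?k * exp (- Re (ip n (mv n G z) z))"
      by (simp only: mult.assoc)
    moreover have "ennreal x * ennreal (exp y) = ennreal (x * exp y)" if "0 \<le> x" for x y :: real
      using that by (intro ennreal_mult[symmetric]) auto
    ultimately show "ennreal ((real n / pi) ^ n * exp (- real n * nsq n z))
        * ennreal (exp (s * (n * Re (ip n (mv n H1 z) z) - Re (trc n H1))))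
        = ennreal ?k * ennreal (exp (- Re (ip n (mv n G z) z)))"
      by simp
  qed
  also have "\<dots> = ennreal ?k * (\<integral>\<^sup>+z. ennreal (exp (- Re (ip n (mv n G z) z))) \<partial>complex_space n)"
  proof (rule nn_integral_cmult)
    have "(\<lambda>x. ennreal (exp (- Re (f x)))) \<in> borel_measurable P"
      if "f \<in> borel_measurable P" for f and P :: "(nat \<Rightarrow> complex) measure"
      using that by measurable
    then show "(\<lambda>z. ennreal (exp (- Re (ip n (mv n G z) z)))) \<in> borel_measurable (complex_space n)"
      using measurable_quadratic_form .
  qed
  \<comment> \<open>The free parameter of the trace bound is taken as n because G = n I at s = 0,
    where this choice makes the bound exact.\<close>
  also have "\<dots> \<le> ennreal ?k * ennreal ((pi / n) ^ n * exp (n * Re (trc n HG) - n))"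
    using n by (intro mult_left_mono nn_integral_gauss_le[OF pdG invG]) auto
  also have "\<dots> = ennreal (?k * ((pi / n) ^ n * exp (s * Re (trc n H2))))"
    unfolding tr by (simp add: ennreal_mult[symmetric])
  also have "\<dots> \<le> ennreal (exp (2 * s\<^sup>2 * n))"
  proof (intro ennreal_leI)
    have 1: "(real n / pi) ^ n * (pi / n) ^ n = 1" using n by (simp add: power_mult_distrib[symmetric])
    have "?k * ((pi / n) ^ n * exp (s * Re (trc n H2))) = exp (- s * Re (trc n H1)) * exp (s * Re (trc n H2))"
    proof -
      have "?k * ((pi / n) ^ n * exp (s * Re (trc n H2)))
         = ((real n / pi) ^ n * (pi / n) ^ n) * (exp (- s * Re (trc n H1)) * exp (s * Re (trc n H2)))"
        by (simp only: mult_ac)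
      then show ?thesis by (simp only: 1 mult_1)
    qed
    also have "\<dots> \<le> exp (2 * s\<^sup>2 * n)"
      unfolding exp_add[symmetric]
      using trc_resolvent[OF W inv1 inv2[unfolded W2_def] W2[unfolded W2_def]] by simp
    finally show "?k * ((pi / n) ^ n * exp (s * Re (trc n H2))) \<le> exp (2 * s\<^sup>2 * n)" .
  qed
  finally show ?thesis unfolding H1_def .
qed

subsection \<open>Concentration of the leave-one-out forms\<close>

text \<open>The centring term is the mean of the quadratic form when z has covariance I / n.\<close>

definition deviation :: "nat \<Rightarrow> (nat \<Rightarrow> nat \<Rightarrow> complex) \<Rightarrow> (nat \<Rightarrow> complex) \<Rightarrow> real" where
  "deviation n W z = Re (ip n (mv n (minv n W) z) z) - Re (trc n (minv n W)) / n"

lemma measurable_deviation: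
  assumes f: "\<And>r s. r < n \<Longrightarrow> s < n \<Longrightarrow> (\<lambda>p. f p r s) \<in> borel_measurable P"
    and pd: "\<And>p. p \<in> space P \<Longrightarrow> pos_def n (f p)"
    and g: "\<And>r. r < n \<Longrightarrow> (\<lambda>p. g p r) \<in> borel_measurable P"
  shows "(\<lambda>p. deviation n (f p) (g p)) \<in> borel_measurable P"
proof -
  have m: "(\<lambda>p. minv n (f p) r s) \<in> borel_measurable P" if "r < n" "s < n" for r s
    using measurable_minv[of n "\<lambda>r s p. f p r s" P r s] f pd that by simp
  have cj: "(\<lambda>p. cnj (h p)) \<in> borel_measurable P" if "h \<in> borel_measurable P" for h
    using borel_measurable_continuous_on[OF continuous_on_cnj[OF continuous_on_id] that] .
  have "(\<lambda>p. ip n (mv n (minv n (f p)) (g p)) (g p)) \<in> borel_measurable P"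
    unfolding ip_def mv_def by (intro borel_measurable_sum borel_measurable_times m g cj) auto
  moreover have "(\<lambda>p. trc n (minv n (f p))) \<in> borel_measurable P"
    unfolding trc_def by (intro borel_measurable_sum m) auto
  ultimately show ?thesis unfolding deviation_def by measurable
qed

text \<open>Markov's inequality is applied to exp (s n d) + exp (- s n d), which covers both tails
  at once and accounts for the factor 2.\<close>

lemma gauss_chernoff:
  assumes W: "bounded_below n 1 W" and n: "0 < n" and \<epsilon>: "0 < \<epsilon>" "\<epsilon> \<le> 2"
  shows "emeasure (density (complex_space n) (\<lambda>z. (real n / pi) ^ n * exp (- real n * nsq n z)))
      {z \<in> space (complex_space n). \<epsilon> \<le> \<bar>deviation n W z\<bar>} \<le> ennreal (2 * exp (- real n * \<epsilon>\<^sup>2 / 8))"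
proof -
  define D where "D = density (complex_space n) (\<lambda>z. ennreal ((real n / pi) ^ n * exp (- real n * nsq n z)))"
  define d where "d = deviation n W"
  \<comment> \<open>The minimiser of 2 s^2 n - s n \<epsilon>, with value - n \<epsilon>^2 / 8;
    \<epsilon> \<le> 2 keeps it within the range s \<le> 1/2 of the moment bound.\<close>
  define s where "s = \<epsilon> / 4"
  have d: "d \<in> borel_measurable D"
    using measurable_deviation[of n "\<lambda>_. W" "complex_space n" "\<lambda>z. z"] bounded_below_imp_pos_def[OF W]
    by (simp add: d_def D_def measurable_coord)
  have eq: "s * (n * Re (ip n (mv n (minv n W) z) z) - Re (trc n (minv n W))) = s * n * d z" for s :: real and z
    using n by (simp add: d_def deviation_def field_simps)
  have I: "(\<integral>\<^sup>+z. ennreal (exp (s' * n * d z)) \<partial>D) \<le> ennreal (exp (2 * s\<^sup>2 * n))" if "s' = s \<or> s' = - s" for s'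
  proof -
    have "\<bar>s'\<bar> \<le> 1 / 2" "s'\<^sup>2 = s\<^sup>2" using that \<epsilon> by (auto simp: s_def)
    moreover have "(\<integral>\<^sup>+z. ennreal (exp (s' * n * d z)) \<partial>D)
       = (\<integral>\<^sup>+z. ennreal (exp (s' * (n * Re (ip n (mv n (minv n W) z) z) - Re (trc n (minv n W))))) \<partial>D)"
      by (intro nn_integral_cong) (simp only: eq)
    ultimately show ?thesis using gauss_mgf_le[OF W n, of s'] unfolding D_def by simp
  qed
  define u where "u z = ennreal (exp (s * n * d z)) + ennreal (exp (- s * n * d z))" for z
  have ed: "(\<lambda>z. ennreal (exp (k * d z))) \<in> borel_measurable D" for k using d by measurable
  have u: "u \<in> borel_measurable D" unfolding u_def by (intro borel_measurable_add ed)
  let ?c = "ennreal (exp (- (s * n * \<epsilon>)))"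
  have "emeasure D {z \<in> space D. \<epsilon> \<le> \<bar>d z\<bar>} \<le> emeasure D {z \<in> space D. 1 \<le> ?c * u z}"
  proof (intro emeasure_mono subsetI)
    show "{z \<in> space D. 1 \<le> ?c * u z} \<in> sets D" using u by measurable
    fix z assume "z \<in> {z \<in> space D. \<epsilon> \<le> \<bar>d z\<bar>}"
    then have z: "z \<in> space D" "\<epsilon> \<le> \<bar>d z\<bar>" by auto
    have sn: "0 < s * n" using \<epsilon> n by (simp add: s_def)
    have "exp (s * n * \<epsilon>) \<le> exp (s * n * \<bar>d z\<bar>)" using z sn by (simp only: exp_le_cancel_iff mult_left_mono less_imp_le)
    also have "\<dots> \<le> exp (s * n * d z) + exp (- s * n * d z)"
      by (cases "0 \<le> d z") (auto simp: abs_if)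
    finally have "1 \<le> exp (- (s * n * \<epsilon>)) * (exp (s * n * d z) + exp (- s * n * d z))"
      by (simp add: exp_minus field_simps)
    then have "ennreal 1 \<le> ennreal (exp (- (s * n * \<epsilon>)) * (exp (s * n * d z) + exp (- s * n * d z)))"
      by (rule ennreal_leI)
    also have "\<dots> = ?c * u z"
      unfolding u_def by (subst ennreal_plus[symmetric]) (auto simp: ennreal_mult add_nonneg_nonneg)
    finally show "z \<in> {z \<in> space D. 1 \<le> ?c * u z}" using z by simp
  qed
  also have "\<dots> \<le> ?c * (\<integral>\<^sup>+z. u z * indicator (space D) z \<partial>D)"
    using u by (intro nn_integral_Markov_inequality) auto
  also have "(\<integral>\<^sup>+z. u z * indicator (space D) z \<partial>D) = (\<integral>\<^sup>+z. u z \<partial>D)"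
    by (intro nn_integral_cong) auto
  also have "\<dots> = (\<integral>\<^sup>+z. ennreal (exp (s * n * d z)) \<partial>D) + (\<integral>\<^sup>+z. ennreal (exp (- s * n * d z)) \<partial>D)"
    unfolding u_def by (intro nn_integral_add ed)
  also have "\<dots> \<le> ennreal (exp (2 * s\<^sup>2 * n)) + ennreal (exp (2 * s\<^sup>2 * n))"
    by (intro add_mono I) auto
  also have "\<dots> = ennreal (2 * exp (2 * s\<^sup>2 * n))" by (subst ennreal_plus[symmetric]) auto
  finally have "emeasure D {z \<in> space D. \<epsilon> \<le> \<bar>d z\<bar>} \<le> ?c * ennreal (2 * exp (2 * s\<^sup>2 * n))"
    by (simp add: mult_left_mono)
  also have "\<dots> = ennreal (exp (- (s * n * \<epsilon>)) * (2 * exp (2 * s\<^sup>2 * n)))" by (rule ennreal_mult[symmetric]) auto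
  also have "exp (- (s * n * \<epsilon>)) * (2 * exp (2 * s\<^sup>2 * n)) = 2 * exp (- real n * \<epsilon>\<^sup>2 / 8)"
  proof -
    have "- (s * n * \<epsilon>) + 2 * s\<^sup>2 * n = - real n * \<epsilon>\<^sup>2 / 8"
      by (simp add: s_def power2_eq_square field_simps)
    then show ?thesis by (simp add: exp_add[symmetric])
  qed
  finally show ?thesis by (simp add: D_def d_def)
qed

lemma gram_cong: "(\<And>j. j \<in> J \<Longrightarrow> \<psi> j = \<psi>' j) \<Longrightarrow> gram c J \<psi> = gram c J \<psi>'"
  by (simp add: gram_def)

lemma (in prob_space) prob_deviation_le:
  fixes \<psi> :: "'s \<Rightarrow> 'a \<Rightarrow> nat \<Rightarrow> complex"
  assumes n: "0 < n" and \<epsilon>: "0 < \<epsilon>" "\<epsilon> \<le> 2"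
    and j: "j \<notin> J" "insert j J \<subseteq> K" and c: "\<And>i. i \<in> J \<Longrightarrow> 0 < c i"
    and dist: "distributed M (complex_space n) (\<psi> j)
           (complex_normal_density n (complex_of_real (1 / real n) \<cdot>\<^sub>m 1\<^sub>m n))"
    and indep: "indep_vars (\<lambda>_. complex_space n) \<psi> K"
  defines "E \<equiv> {\<omega> \<in> space M. \<epsilon> \<le> \<bar>deviation n (gram c J (\<lambda>i. \<psi> i \<omega>)) (\<psi> j \<omega>)\<bar>}"
  shows "E \<in> events" "prob E \<le> 2 * exp (- real n * \<epsilon>\<^sup>2 / 8)"
proof -
  define S where "S = complex_space n"
  define S' where "S' = (\<Pi>\<^sub>M i\<in>{j}. S)"
  define T where "T = (\<Pi>\<^sub>M i\<in>J. S)"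
  define X where "X \<omega> = restrict (\<lambda>i. \<psi> i \<omega>) {j}" for \<omega>
  define Y where "Y \<omega> = restrict (\<lambda>i. \<psi> i \<omega>) J" for \<omega>
  define F where "F p = deviation n (gram c J (snd p)) (fst p j)" for p :: "('s \<Rightarrow> nat \<Rightarrow> complex) \<times> ('s \<Rightarrow> nat \<Rightarrow> complex)"
  define B where "B = {p \<in> space (S' \<Otimes>\<^sub>M T). \<epsilon> \<le> \<bar>F p\<bar>}"
  let ?b = "ennreal (2 * exp (- real n * \<epsilon>\<^sup>2 / 8))"
  have pd: "pos_def n (gram c J y)" for y
    by (rule bounded_below_imp_pos_def[OF gram_bounded_below[OF c]])
  have Fm: "F \<in> borel_measurable (S' \<Otimes>\<^sub>M T)"
    unfolding F_def
  proof (rule measurable_deviation)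
    have co: "(\<lambda>p. snd p i r) \<in> borel_measurable (S' \<Otimes>\<^sub>M T)" if "i \<in> J" "r < n" for i r
    proof -
      have "(\<lambda>p. snd p i) \<in> measurable (S' \<Otimes>\<^sub>M T) S"
        unfolding T_def using that(1) by (intro measurable_compose[OF measurable_snd] measurable_component_singleton)
      then show ?thesis
        unfolding S_def by (rule measurable_compose) (rule measurable_coord[OF that(2)])
    qed
    have cj: "(\<lambda>p. cnj (h p)) \<in> borel_measurable (S' \<Otimes>\<^sub>M T)" if "h \<in> borel_measurable (S' \<Otimes>\<^sub>M T)" for h
      using borel_measurable_continuous_on[OF continuous_on_cnj[OF continuous_on_id] that] .
    show "(\<lambda>p. gram c J (snd p) r s) \<in> borel_measurable (S' \<Otimes>\<^sub>M T)" if "r < n" "s < n" for r s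
      unfolding gram_def
      by (intro borel_measurable_add borel_measurable_sum borel_measurable_times borel_measurable_const cj co that)
    show "(\<lambda>p. fst p j r) \<in> borel_measurable (S' \<Otimes>\<^sub>M T)" if "r < n" for r
    proof -
      have "(\<lambda>p. fst p j) \<in> measurable (S' \<Otimes>\<^sub>M T) S"
        unfolding S'_def by (intro measurable_compose[OF measurable_fst] measurable_component_singleton) simp
      then show ?thesis
        unfolding S_def by (rule measurable_compose) (rule measurable_coord[OF that])
    qed
  qed (rule pd)
  have B: "B \<in> sets (S' \<Otimes>\<^sub>M T)" unfolding B_def using Fm by measurable
  have "indep_var S' X T Y"
    unfolding S'_def S_def T_def X_def[abs_def] Y_def[abs_def] using j
    by (intro indep_var_restrict[OF indep]) auto
  then have X: "X \<in> measurable M S'" and Ym: "Y \<in> measurable M T"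
    and pair: "distr M S' X \<Otimes>\<^sub>M distr M T Y = distr M (S' \<Otimes>\<^sub>M T) (\<lambda>x. (X x, Y x))"
    unfolding indep_var_distribution_eq by auto
  have XY: "(\<lambda>x. (X x, Y x)) \<in> measurable M (S' \<Otimes>\<^sub>M T)" using X Ym by (rule measurable_Pair)
  have FY: "F (X \<omega>, Y \<omega>) = deviation n (gram c J (\<lambda>i. \<psi> i \<omega>)) (\<psi> j \<omega>)" for \<omega>
    using gram_cong[of J "Y \<omega>" "\<lambda>i. \<psi> i \<omega>" c] by (simp add: F_def Y_def X_def)
  have E: "E = (\<lambda>x. (X x, Y x)) -` B \<inter> space M"
    using measurable_space[OF XY] by (auto simp: E_def B_def FY)
  show "E \<in> events" unfolding E using measurable_sets[OF XY B] .
  interpret D1: prob_space "distr M S' X" using X by (rule prob_space_distr)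
  interpret D2: prob_space "distr M T Y" using Ym by (rule prob_space_distr)
  interpret P: pair_sigma_finite "distr M S' X" "distr M T Y" ..
  have psi: "\<psi> j \<in> measurable M S"
    and D: "distr M S (\<psi> j) = density S (\<lambda>z. (real n / pi) ^ n * exp (- real n * nsq n z))"
    using dist unfolding distributed_def S_def complex_normal_density_scaled[OF n] by auto
  have slice: "emeasure (distr M S' X) ((\<lambda>x. (x, y)) -` B) \<le> ?b" if y: "y \<in> space T" for y
  proof -
    define A where "A = {z \<in> space S. \<epsilon> \<le> \<bar>deviation n (gram c J y) z\<bar>}"
    have A: "A \<in> sets S"
    proof -
      have "deviation n (gram c J y) \<in> borel_measurable S"
        using measurable_deviation[of n "\<lambda>_. gram c J y" S "\<lambda>z. z"] pd by (simp add: S_def measurable_coord)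
      then show ?thesis unfolding A_def by measurable
    qed
    have "(\<lambda>x. (x, y)) -` B \<in> sets S'" using B by (rule sets_Pair2)
    then have "emeasure (distr M S' X) ((\<lambda>x. (x, y)) -` B) = emeasure M (X -` (\<lambda>x. (x, y)) -` B \<inter> space M)"
      using X by (intro emeasure_distr)
    also have "X -` (\<lambda>x. (x, y)) -` B \<inter> space M = \<psi> j -` A \<inter> space M"
      using y measurable_space[OF X] measurable_space[OF psi]
      by (auto simp: B_def A_def F_def space_pair_measure X_def)
    also have "emeasure M \<dots> = emeasure (distr M S (\<psi> j)) A"
      using emeasure_distr[OF psi A] by simp
    also have "\<dots> \<le> ?b"
      using gauss_chernoff[OF gram_bounded_below[OF c] n \<epsilon>] unfolding D A_def by (simp only: S_def)
    finally show ?thesis .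
  qed
  have "emeasure M E = emeasure (distr M (S' \<Otimes>\<^sub>M T) (\<lambda>x. (X x, Y x))) B"
    unfolding E using emeasure_distr[OF XY B] by simp
  \<comment> \<open>Slicing the product law at fixed values of the pilots in J.\<close>
  also have "\<dots> = (\<integral>\<^sup>+y. emeasure (distr M S' X) ((\<lambda>x. (x, y)) -` B) \<partial>distr M T Y)"
    unfolding pair[symmetric] using B by (intro P.emeasure_pair_measure_alt2) simp
  also have "\<dots> \<le> (\<integral>\<^sup>+y. ?b \<partial>distr M T Y)"
    using slice by (intro nn_integral_mono) simp
  also have "\<dots> = ?b"
    using D2.emeasure_space_1 by simp
  finally show "prob E \<le> 2 * exp (- real n * \<epsilon>\<^sup>2 / 8)"
    by (simp add: emeasure_eq_measure)
qed

subsection \<open>Rank-one updates and the deterministic equation\<close>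

lemma gram_minv:
  assumes "\<And>j. j \<in> J \<Longrightarrow> 0 < c j"
  shows "right_inverse n (gram c J \<psi>) (minv n (gram c J \<psi>))"
    "right_inverse n (minv n (gram c J \<psi>)) (gram c J \<psi>)" "herm n (minv n (gram c J \<psi>))"
proof -
  note W = gram_bounded_below[of J c n \<psi>, OF assms]
  show inv: "right_inverse n (gram c J \<psi>) (minv n (gram c J \<psi>))"
    "right_inverse n (minv n (gram c J \<psi>)) (gram c J \<psi>)"
    using minv_inverse[OF bounded_below_imp_pos_def[OF W]] by auto
  show "herm n (minv n (gram c J \<psi>))"
    using herm_right_inverse[OF _ inv(1)] W by (simp add: bounded_below_def)
qed

lemma herm_form_real:
  assumes "herm n A"
  shows "ip n (mv n A x) x = of_real (Re (ip n (mv n A x) x))"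
proof -
  have "cnj (ip n (mv n A x) x) = ip n (mv n A x) x" by (simp only: cnj_ip ip_mv_herm[OF assms])
  then show ?thesis by (simp add: complex_eq_iff)
qed

text \<open>Sherman--Morrison\<close>

lemma gram_insert_resolvent:
  assumes J: "finite J" "j \<notin> J" and c: "\<And>i. i \<in> insert j J \<Longrightarrow> 0 < c i" and r: "r < n"
  shows "mv n (minv n (gram c (insert j J) \<psi>)) x r = mv n (minv n (gram c J \<psi>)) x r
    - of_real (c j) * ip n (mv n (minv n (gram c (insert j J) \<psi>)) x) (\<psi> j) * mv n (minv n (gram c J \<psi>)) (\<psi> j) r"
proof -
  have cJ: "\<And>i. i \<in> J \<Longrightarrow> 0 < c i" using c by simp
  define y where "y = mv n (minv n (gram c (insert j J) \<psi>)) x"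
  have "mv n (gram c J \<psi>) y i = x i - of_real (c j) * ip n y (\<psi> j) * \<psi> j i" if "i < n" for i
  proof -
    have "x i = mv n (gram c (insert j J) \<psi>) y i"
      unfolding y_def by (rule mv_right_inverse[OF gram_minv(1)[of "insert j J" c n \<psi>, OF c] that, symmetric])
    then show ?thesis unfolding mv_gram[OF that] using J by simp
  qed
  from right_inverse_unique[OF gram_minv(1,2)[of J c n \<psi>, OF cJ] this r]
  show ?thesis unfolding y_def[symmetric] by (simp add: mv_diff mv_scale)
qed

lemma gram_form_nonneg:
  assumes c: "\<And>j. j \<in> J \<Longrightarrow> 0 < c j"
  shows "0 \<le> Re (ip n (mv n (minv n (gram c J \<psi>)) x) x)"
  using ip_inverse_lower[OF gram_bounded_below[of J c n \<psi>, OF c] gram_minv(1)[of J c n \<psi>, OF c], of x]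
    nsq_nonneg[of n "mv n (minv n (gram c J \<psi>)) x"] by simp

text \<open>Pairing the rank-one resolvent formula with \<psi> j gives the scalar equation p = q - c
  p q. It trades a form whose matrix contains pilot j for one whose matrix does not.\<close>

lemma gram_insert_form:
  fixes \<psi> :: "'s \<Rightarrow> nat \<Rightarrow> complex" and n :: nat
  assumes J: "finite J" "j \<notin> J" and c: "\<And>i. i \<in> insert j J \<Longrightarrow> 0 < c i"
  defines "q \<equiv> Re (ip n (mv n (minv n (gram c J \<psi>)) (\<psi> j)) (\<psi> j))"
    and "p \<equiv> Re (ip n (mv n (minv n (gram c (insert j J) \<psi>)) (\<psi> j)) (\<psi> j))"
  shows "p = q / (1 + c j * q)"
proof -
  have cJ: "\<And>i. i \<in> J \<Longrightarrow> 0 < c i" using c by simp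
  let ?H = "minv n (gram c J \<psi>)" and ?H' = "minv n (gram c (insert j J) \<psi>)"
  have q: "ip n (mv n ?H (\<psi> j)) (\<psi> j) = of_real q" and p: "ip n (mv n ?H' (\<psi> j)) (\<psi> j) = of_real p"
    unfolding q_def p_def
    using herm_form_real[OF gram_minv(3)[of J c n \<psi>, OF cJ]]
      herm_form_real[OF gram_minv(3)[of "insert j J" c n \<psi>, OF c]] by auto
  have "complex_of_real p = ip n (\<lambda>r. mv n ?H (\<psi> j) r - (of_real (c j) * of_real p) * mv n ?H (\<psi> j) r) (\<psi> j)"
    unfolding p[symmetric]
    by (intro ip_cong refl) (simp only: p[symmetric] gram_insert_resolvent[of J j c _ n \<psi> "\<psi> j", OF J c])
  also have "\<dots> = of_real q - of_real (c j) * of_real p * of_real q"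
    by (simp only: ip_diff_left ip_scale_left q)
  finally have "complex_of_real p = of_real (q - c j * p * q)" by simp
  then have "p = q - c j * p * q" by (simp only: of_real_eq_iff)
  moreover have "0 < 1 + c j * q"
    using gram_form_nonneg[of J c n \<psi> "\<psi> j", OF cJ] c[of j] unfolding q_def by (simp add: add_pos_nonneg)
  ultimately show ?thesis by (simp add: field_simps)
qed

text \<open>With h = W^-1 \<psi> j, the trace drops by c times the squared norm of h over 1 + c q.
  That squared norm is at most q because W \<ge> I, so the quotient is at most c q / (1 + c q) \<le>
  1, however large c is.\<close>

lemma gram_insert_trace:
  assumes J: "finite J" "j \<notin> J" and c: "\<And>i. i \<in> insert j J \<Longrightarrow> 0 < c i"
  shows "\<bar>Re (trc n (minv n (gram c J \<psi>))) - Re (trc n (minv n (gram c (insert j J) \<psi>)))\<bar> \<le> 1"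
proof -
  have cJ: "\<And>i. i \<in> J \<Longrightarrow> 0 < c i" using c by simp
  let ?H = "minv n (gram c J \<psi>)" and ?H' = "minv n (gram c (insert j J) \<psi>)"
  define h where "h = mv n ?H (\<psi> j)"
  define h' where "h' = mv n ?H' (\<psi> j)"
  define q where "q = Re (ip n h (\<psi> j))"
  define p where "p = Re (ip n h' (\<psi> j))"
  have pq: "p = q / (1 + c j * q)" unfolding p_def q_def h_def h'_def by (rule gram_insert_form[OF J c])
  have herm': "herm n ?H'" by (rule gram_minv(3)[of "insert j J" c n \<psi>, OF c])
  have p: "ip n h' (\<psi> j) = of_real p" unfolding p_def h'_def by (rule herm_form_real[OF herm'])
  have q0: "0 \<le> q" unfolding q_def h_def by (rule gram_form_nonneg[of J c, OF cJ])
  have cq: "0 < 1 + c j * q" using q0 c[of j] by (simp add: add_pos_nonneg)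
  \<comment> \<open>After insertion the solution for \<psi> j stays parallel to h, with a real
    factor; this turns the inner product of h and h' into a squared norm.\<close>
  have h'h: "h' r = of_real (1 - c j * p) * h r" if "r < n" for r
    using gram_insert_resolvent[of J j c r n \<psi> "\<psi> j", OF J c that] unfolding h_def[symmetric] h'_def[symmetric] p
    by (simp add: algebra_simps)
  have "trc n ?H' = (\<Sum>r<n. mv n ?H' (unit_fun r) r)" by (simp add: trc_def mv_unit)
  also have "\<dots> = (\<Sum>r<n. ?H r r - of_real (c j) * (h r * cnj (h' r)))"
  proof (intro sum.cong refl)
    fix r assume "r \<in> {..<n}"
    then have r: "r < n" by simp
    have "ip n (mv n ?H' (unit_fun r)) (\<psi> j) = cnj (h' r)"
      unfolding ip_mv_herm[OF herm'] h'_def by (rule ip_unit_left[OF r])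
    then show "mv n ?H' (unit_fun r) r = ?H r r - of_real (c j) * (h r * cnj (h' r))"
      using gram_insert_resolvent[of J j c r n \<psi> "unit_fun r", OF J c r] r
      by (simp add: mv_unit h_def)
  qed
  also have "\<dots> = trc n ?H - of_real (c j) * ip n h h'"
    by (simp add: sum_subtractf trc_def ip_def sum_distrib_left)
  also have "ip n h h' = ip n h (\<lambda>r. of_real (1 - c j * p) * h r)" using h'h by (intro ip_cong) auto
  also have "\<dots> = of_real ((1 - c j * p) * nsq n h)" by (simp only: ip_scale_right ip_self) simp
  finally have "Re (trc n ?H) - Re (trc n ?H') = c j * ((1 - c j * p) * nsq n h)" by simp
  also have "1 - c j * p = 1 / (1 + c j * q)" unfolding pq using cq by (simp add: field_simps)
  finally have eq: "Re (trc n ?H) - Re (trc n ?H') = c j * nsq n h / (1 + c j * q)" by simp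
  have "nsq n h \<le> q"
    using ip_inverse_lower[OF gram_bounded_below[of J c n \<psi>, OF cJ] gram_minv(1)[of J c n \<psi>, OF cJ], of "\<psi> j"]
    by (simp add: q_def h_def)
  then have "c j * nsq n h \<le> c j * q" using c[of j] by simp
  then have "c j * nsq n h / (1 + c j * q) \<le> 1" using cq by (simp add: field_simps)
  moreover have "0 \<le> c j * nsq n h / (1 + c j * q)" using cq c[of j] nsq_nonneg[of n h] by simp
  ultimately show ?thesis by (simp only: eq abs_of_nonneg)
qed

lemma gram_trace_identity:
  assumes J: "finite J" and c: "\<And>i. i \<in> J \<Longrightarrow> 0 < c i"
  shows "real n = Re (trc n (minv n (gram c J \<psi>)))
    + (\<Sum>j\<in>J. c j * Re (ip n (mv n (minv n (gram c J \<psi>)) (\<psi> j)) (\<psi> j)))"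
proof -
  let ?H = "minv n (gram c J \<psi>)"
  have hH: "herm n ?H" by (rule gram_minv(3)[of J c n \<psi>, OF c])
  have "complex_of_nat n = (\<Sum>r<n. mv n (gram c J \<psi>) (mv n ?H (unit_fun r)) r)"
    using mv_right_inverse[OF gram_minv(1)[of J c n \<psi>, OF c]] by (simp add: unit_fun_def del: mv_unit)
  also have "\<dots> = (\<Sum>r<n. ?H r r + (\<Sum>j\<in>J. of_real (c j) * (\<psi> j r * cnj (mv n ?H (\<psi> j) r))))"
  proof (intro sum.cong refl)
    fix r assume "r \<in> {..<n}"
    then have r: "r < n" by simp
    have "ip n (mv n ?H (unit_fun r)) (\<psi> j) = cnj (mv n ?H (\<psi> j) r)" for j
      unfolding ip_mv_herm[OF hH] by (rule ip_unit_left[OF r])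
    then show "mv n (gram c J \<psi>) (mv n ?H (unit_fun r)) r
        = ?H r r + (\<Sum>j\<in>J. of_real (c j) * (\<psi> j r * cnj (mv n ?H (\<psi> j) r)))"
      unfolding mv_gram[OF r] using r by (simp add: mv_unit mult_ac)
  qed
  also have "\<dots> = trc n ?H + (\<Sum>j\<in>J. of_real (c j) * ip n (\<psi> j) (mv n ?H (\<psi> j)))"
    unfolding sum.distrib trc_def ip_def sum_distrib_left by (simp add: sum.swap[of _ J])
  finally have "Re (complex_of_nat n) = Re (trc n ?H + (\<Sum>j\<in>J. of_real (c j) * ip n (\<psi> j) (mv n ?H (\<psi> j))))"
    by simp
  then show ?thesis by (simp add: ip_mv_herm[OF hH])
qed

section \<open>The scalar equation behind the fixed-point system\<close>

definition fix_map :: "nat \<Rightarrow> ('s \<Rightarrow> real) \<Rightarrow> 's set \<Rightarrow> real \<Rightarrow> real" where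
  "fix_map t c J m = m + (\<Sum>j\<in>J. c j * m / (t * (1 + c j * m)))"

lemma fix_map_term_mono:
  fixes t :: nat and c x y :: real
  assumes "0 < c" "0 \<le> x" "x \<le> y"
  shows "c * x / (t * (1 + c * x)) \<le> c * y / (t * (1 + c * y))"
proof -
  have "c * x \<le> c * y" "0 \<le> c * x" using assms by auto
  then have "c * x / (1 + c * x) \<le> c * y / (1 + c * y)" by (simp add: divide_simps algebra_simps)
  then have "c * x / (1 + c * x) / t \<le> c * y / (1 + c * y) / t" by (rule divide_right_mono) simp
  then show ?thesis by (simp add: mult.commute)
qed

lemma fix_map_growth:
  assumes c: "\<And>j. j \<in> J \<Longrightarrow> 0 < c j" and m: "0 \<le> x" "x \<le> y"
  shows "y - x \<le> fix_map t c J y - fix_map t c J x"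
proof -
  have "(\<Sum>j\<in>J. c j * x / (t * (1 + c j * x))) \<le> (\<Sum>j\<in>J. c j * y / (t * (1 + c j * y)))"
    using c m by (intro sum_mono fix_map_term_mono)
  then show ?thesis by (simp add: fix_map_def)
qed

lemma fix_map_inj:
  assumes "\<And>j. j \<in> J \<Longrightarrow> 0 < c j" "0 \<le> x" "0 \<le> y" "fix_map t c J x = fix_map t c J y"
  shows "x = y"
proof (cases "x \<le> y")
  case True
  with fix_map_growth[of J c x y t, OF assms(1,2)] assms(4) show ?thesis by simp
next
  case False
  with fix_map_growth[of J c y x t, OF assms(1,3)] assms(4) show ?thesis by simp
qed

text \<open>A solution of the system must be c j times a common factor m, and the system then reads
  m g(m) = 1, that is \<open>fix_map\<close> = 1. A root lies in [0, 1] by the intermediate value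
  theorem, since the map is 0 at 0 and at least 1 at 1; injectivity gives uniqueness, so the
  description by \<open>THE\<close> is met.\<close>

lemma Z_det_fix_map:
  fixes b :: "'s \<Rightarrow> real"
  assumes J: "finite J" and c: "\<And>j. j \<in> J \<Longrightarrow> 0 < Ep * b j" and t: "0 < t"
  shows "0 < Z_det t Ep b J" "fix_map t (\<lambda>j. Ep * b j) J (Z_det t Ep b J) = 1"
proof -
  let ?c = "\<lambda>j. Ep * b j"
  let ?g = "\<lambda>m. 1 + (\<Sum>i\<in>J. ?c i / (real t * (1 + ?c i * m)))"
  let ?P = "\<lambda>s. s \<in> J \<rightarrow>\<^sub>E {0<..} \<and>
       (\<forall>j\<in>J. s j = Ep * b j * inverse (1 + (\<Sum>i\<in>J. Ep * b i / (real t * (1 + s i)))))"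
  have fm: "fix_map t ?c J m = m * ?g m" for m
    by (simp add: fix_map_def distrib_left sum_distrib_left mult.commute)
  have "\<exists>m\<ge>0. m \<le> 1 \<and> fix_map t ?c J m = 1"
  proof (rule IVT)
    show "fix_map t ?c J 0 \<le> 1" by (simp add: fix_map_def)
    show "1 \<le> fix_map t ?c J 1" using fix_map_growth[of J ?c 0 1 t] c by (simp add: fix_map_def)
    show "\<forall>x. 0 \<le> x \<and> x \<le> 1 \<longrightarrow> isCont (fix_map t ?c J) x"
    proof safe
      fix x :: real assume x: "0 \<le> x"
      have "t * (1 + ?c j * x) \<noteq> 0" if "j \<in> J" for j
      proof -
        have "0 \<le> ?c j * x" by (rule mult_nonneg_nonneg[OF less_imp_le[OF c[OF that]] x])
        then show ?thesis using t by simp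
      qed
      then show "isCont (fix_map t ?c J) x"
        unfolding fix_map_def[abs_def] by (intro continuous_intros) auto
    qed
  qed simp
  then obtain m where m0: "0 \<le> m" and m: "fix_map t ?c J m = 1" by auto
  have mpos: "0 < m" using m0 m by (cases "m = 0") (auto simp: fix_map_def)
  have "?g m * m = 1" using m unfolding fm by (simp only: mult.commute)
  then have inv_g: "inverse (?g m) = m" by (rule inverse_unique)
  define s where "s = restrict (\<lambda>j. ?c j * m) J"
  have sum_s: "(\<Sum>i\<in>J. ?c i / (real t * (1 + s i))) = (\<Sum>i\<in>J. ?c i / (real t * (1 + ?c i * m)))"
    by (intro sum.cong) (auto simp: s_def)
  have Ps: "?P s"
    unfolding sum_s inv_g using c mpos by (auto simp: s_def)
  moreover have "s' = s" if P: "?P s'" for s'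
  proof -
    \<comment> \<open>The factor shared by all components of an arbitrary solution; it is shown to
      be a root of the same scalar equation.\<close>
    define m' where "m' = inverse (1 + (\<Sum>i\<in>J. ?c i / (real t * (1 + s' i))))"
    have s': "s' j = ?c j * m'" if "j \<in> J" for j using P that unfolding m'_def by blast
    have Pm: "s' \<in> J \<rightarrow>\<^sub>E {0<..}" using P by (rule conjunct1)
    have s'0: "0 < s' j" if "j \<in> J" for j using PiE_mem[OF Pm that] by simp
    have "0 \<le> (\<Sum>i\<in>J. ?c i / (real t * (1 + s' i)))"
    proof (rule sum_nonneg)
      fix i assume i: "i \<in> J"
      have "0 < 1 + s' i" using s'0[OF i] by simp
      then have "0 < real t * (1 + s' i)" using t by (intro mult_pos_pos) auto
      then show "0 \<le> ?c i / (real t * (1 + s' i))" using c[OF i] by (intro divide_nonneg_pos less_imp_le)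
    qed
    then have m'pos: "0 < m'" unfolding m'_def by (simp add: add_pos_nonneg)
    have "(\<Sum>i\<in>J. ?c i / (real t * (1 + s' i))) = (\<Sum>i\<in>J. ?c i / (real t * (1 + ?c i * m')))"
      by (intro sum.cong refl) (simp only: s')
    with m'_def have "m' = inverse (?g m')" by (rule back_subst[of "\<lambda>z. m' = inverse (1 + z)"])
    then have "inverse m' = inverse (inverse (?g m'))" by (rule arg_cong)
    also have "\<dots> = ?g m'" by (rule inverse_inverse_eq)
    finally have "inverse m' = ?g m'" .
    then have "m' * ?g m' = 1" using m'pos by (metis less_irrefl right_inverse)
    then have "fix_map t ?c J m' = fix_map t ?c J m" unfolding fm m[unfolded fm] .
    then have "m' = m" using fix_map_inj[of J ?c m' m t] c m'pos m0 by simp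
    show "s' = s"
    proof (rule extensionalityI[of _ J])
      show "s' \<in> extensional J" using Pm by (simp add: PiE_def)
      show "s' j = s j" if "j \<in> J" for j
        unfolding s'[OF that] \<open>m' = m\<close> using that by (simp add: s_def)
    qed (simp add: s_def)
  qed
  ultimately have "fixed_point t Ep b J = s"
    unfolding fixed_point_def by (rule the_equality)
  then have "Z_det t Ep b J = m" unfolding Z_det_def using sum_s inv_g by simp
  then show "0 < Z_det t Ep b J" "fix_map t ?c J (Z_det t Ep b J) = 1" using mpos m by auto
qed

text \<open>Monotonicity of the fixed-point map turns entrywise closeness of the leave-one-out forms into
  closeness to its root, without any bound on the weights c.\<close>

lemma fix_map_stable:
  assumes c: "\<And>j. j \<in> J \<Longrightarrow> 0 < c j" and M: "0 \<le> M" and m: "0 \<le> m" "fix_map t c J m = 1"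
    and q: "\<And>j. j \<in> J \<Longrightarrow> 0 \<le> q j" "\<And>j. j \<in> J \<Longrightarrow> \<bar>q j - M\<bar> \<le> e" and e: "0 \<le> e"
    and id: "M + (\<Sum>j\<in>J. c j * q j / (t * (1 + c j * q j))) = 1"
  shows "\<bar>M - m\<bar> \<le> e"
proof -
  have "m \<le> M + e"
  proof (rule ccontr)
    assume "\<not> m \<le> M + e"
    then have lt: "M + e < m" by simp
    have "1 \<le> fix_map t c J (M + e)"
    proof -
      have "(\<Sum>j\<in>J. c j * q j / (t * (1 + c j * q j))) \<le> (\<Sum>j\<in>J. c j * (M + e) / (t * (1 + c j * (M + e))))"
      proof (intro sum_mono fix_map_term_mono)
        fix j assume j: "j \<in> J"
        show "0 < c j" "0 \<le> q j" "q j \<le> M + e" using c[OF j] q[OF j] by auto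
      qed
      then show ?thesis using id e by (simp add: fix_map_def)
    qed
    moreover have "m - (M + e) \<le> fix_map t c J m - fix_map t c J (M + e)"
      using fix_map_growth[of J c "M + e" m t] c lt M e by simp
    ultimately show False using lt m(2) by simp
  qed
  moreover have "M - e \<le> m"
  proof (rule ccontr)
    assume "\<not> M - e \<le> m"
    \<comment> \<open>Together with m \<ge> 0 this makes M - e nonnegative, so the monotonicity of
      the summands applies there.\<close>
    then have lt: "m < M - e" by simp
    have "fix_map t c J (M - e) \<le> 1"
    proof -
      have "(\<Sum>j\<in>J. c j * (M - e) / (t * (1 + c j * (M - e)))) \<le> (\<Sum>j\<in>J. c j * q j / (t * (1 + c j * q j)))"
      proof (intro sum_mono fix_map_term_mono)
        fix j assume j: "j \<in> J"
        show "0 < c j" "0 \<le> M - e" "M - e \<le> q j" using c[OF j] q(2)[OF j] lt m(1) by auto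
      qed
      then show ?thesis using id e by (simp add: fix_map_def)
    qed
    moreover have "(M - e) - m \<le> fix_map t c J (M - e) - fix_map t c J m"
      using fix_map_growth[of J c m "M - e" t] c lt m(1) by simp
    ultimately show False using lt m(2) by simp
  qed
  ultimately show ?thesis by simp
qed

subsection \<open>Convergence of the estimates\<close>

text \<open>The error budget is e for each q j against its own trace, 1 / n for restoring the
  deleted pilot j, and another e for comparing q k with the trace of \<open>A - {k}\<close>. This
  part is deterministic: all randomness sits in the hypothesis on \<open>deviation\<close>.\<close>

lemma gamma_lmmse_approx:
  fixes b :: "'s \<Rightarrow> real"
  assumes A: "finite A" "k \<in> A" and Ep: "0 < Ep" and c: "\<And>j. j \<in> A \<Longrightarrow> 0 < b j" and n: "0 < n"
    and dev: "\<And>j. j \<in> A \<Longrightarrow>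
      \<bar>deviation n (gram (\<lambda>j. Ep * b j) (A - {k} - {j}) \<psi>) (\<psi> j)\<bar> \<le> e"
  shows "\<bar>gamma_lmmse n Ep b A \<psi> k - gamma_bar n Ep b A k\<bar> \<le> Ep * (b k)\<^sup>2 * (2 * e + 1 / n)"
proof -
  define c where "c = (\<lambda>j. Ep * b j)"
  define J where "J = A - {k}"
  define H where "H J' = minv n (gram c J' \<psi>)" for J'
  define q where "q j = Re (ip n (mv n (H (J - {j})) (\<psi> j)) (\<psi> j))" for j
  define M where "M J' = Re (trc n (H J')) / n" for J'
  define m where "m = Z_det n Ep b J"
  have finJ: "finite J" and kJ: "k \<notin> J" "J - {k} = J" "insert k J = A" using A by (auto simp: J_def)
  have cA: "0 < c j" if "j \<in> A" for j using assms(4)[OF that] Ep by (simp add: c_def)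
  have cJ: "0 < c j" if "j \<in> J" for j using cA that by (simp add: J_def)
  have e0: "0 \<le> e" using dev[OF A(2)] by simp
  have dv: "\<bar>q j - M (J - {j})\<bar> \<le> e" if "j \<in> A" for j
    using dev[OF that] by (simp add: deviation_def q_def M_def H_def J_def c_def)
  have q0: "0 \<le> q j" for j
    unfolding q_def H_def using cJ by (intro gram_form_nonneg) simp
  have MJ: "\<bar>M (J - {j}) - M J\<bar> \<le> 1 / n" if "j \<in> J" for j
  proof -
    have ij: "insert j (J - {j}) = J" using that by auto
    have "\<bar>Re (trc n (H (J - {j}))) - Re (trc n (H J))\<bar> \<le> 1"
      using gram_insert_trace[of "J - {j}" j c n \<psi>] finJ cJ unfolding ij H_def by simp
    then have "\<bar>Re (trc n (H (J - {j}))) - Re (trc n (H J))\<bar> / n \<le> 1 / n" by (rule divide_right_mono) simp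
    then show ?thesis by (simp add: M_def diff_divide_distrib[symmetric])
  qed
  have mpos: "0 < m" and mfix: "fix_map n c J m = 1"
    using Z_det_fix_map[of J Ep b n] finJ cJ n unfolding m_def c_def by auto
  have M0: "0 \<le> M J"
    unfolding M_def trc_eq_ip Re_sum H_def using cJ
    by (intro divide_nonneg_nonneg sum_nonneg gram_form_nonneg) auto
  have "real n = Re (trc n (H J)) + (\<Sum>j\<in>J. c j * Re (ip n (mv n (H J) (\<psi> j)) (\<psi> j)))"
    unfolding H_def by (rule gram_trace_identity[OF finJ cJ])
  also have "(\<Sum>j\<in>J. c j * Re (ip n (mv n (H J) (\<psi> j)) (\<psi> j))) = (\<Sum>j\<in>J. c j * q j / (1 + c j * q j))"
  proof (intro sum.cong refl)
    fix j assume j: "j \<in> J"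
    then have ij: "insert j (J - {j}) = J" by auto
    have "Re (ip n (mv n (H J) (\<psi> j)) (\<psi> j)) = q j / (1 + c j * q j)"
      using gram_insert_form[of "J - {j}" j c n \<psi>] finJ cJ unfolding ij H_def q_def by simp
    then show "c j * Re (ip n (mv n (H J) (\<psi> j)) (\<psi> j)) = c j * q j / (1 + c j * q j)" by simp
  qed
  finally have "1 = (Re (trc n (H J)) + (\<Sum>j\<in>J. c j * q j / (1 + c j * q j))) / n" using n by simp
  then have id: "M J + (\<Sum>j\<in>J. c j * q j / (n * (1 + c j * q j))) = 1"
    by (simp add: add_divide_distrib M_def sum_divide_distrib mult.commute)
  have "\<bar>M J - m\<bar> \<le> e + 1 / n"
  proof (rule fix_map_stable[OF cJ M0 less_imp_le[OF mpos] mfix q0 _ _ id])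
    show "\<bar>q j - M J\<bar> \<le> e + 1 / n" if "j \<in> J" for j
    proof -
      have "j \<in> A" using that by (simp add: J_def)
      then show ?thesis using dv[of j] MJ[OF that] by linarith
    qed
    show "0 \<le> e + 1 / n" using e0 by (intro add_nonneg_nonneg) auto
  qed
  moreover have "\<bar>q k - M J\<bar> \<le> e" using dv[OF A(2)] kJ by simp
  ultimately have qm: "\<bar>q k - m\<bar> \<le> 2 * e + 1 / n" by linarith
  have p: "Re (ip n (mv n (H A) (\<psi> k)) (\<psi> k)) = q k / (1 + c k * q k)"
    using gram_insert_form[of J k c n \<psi>] finJ kJ cA unfolding kJ H_def q_def by simp
  have pd: "pos_def n (gram c A \<psi>)"
    using bounded_below_imp_pos_def[OF gram_bounded_below[of A c n \<psi>]] cA by simp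
  have g1: "gamma_lmmse n Ep b A \<psi> k = Ep * (b k)\<^sup>2 * (q k / (1 + c k * q k))"
    unfolding gamma_lmmse_def Z_mat_eq c_def[symmetric] inv_form_eq[OF pd] p[unfolded H_def] ..
  have g2: "gamma_bar n Ep b A k = Ep * (b k)\<^sup>2 * (m / (1 + c k * m))"
    by (simp add: gamma_bar_def Let_def m_def J_def c_def)
  have pos: "1 \<le> 1 + c k * q k" "1 \<le> 1 + c k * m"
    using cA[OF A(2)] q0[of k] mpos by auto
  \<comment> \<open>Over the common denominator the numerator is just q k - m, and both denominators
    are at least 1, so no constant depending on c k appears.\<close>
  have "q k / (1 + c k * q k) - m / (1 + c k * m) = (q k - m) / ((1 + c k * q k) * (1 + c k * m))"
    using pos by (simp add: field_simps)
  also have "\<bar>\<dots>\<bar> = \<bar>q k - m\<bar> / ((1 + c k * q k) * (1 + c k * m))"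
    using pos by (simp add: abs_mult)
  also have "\<dots> \<le> \<bar>q k - m\<bar> / 1"
    using mult_mono[OF pos] pos by (intro divide_left_mono) auto
  finally have "\<bar>q k / (1 + c k * q k) - m / (1 + c k * m)\<bar> \<le> 2 * e + 1 / n" using qm by simp
  then have "Ep * (b k)\<^sup>2 * \<bar>q k / (1 + c k * q k) - m / (1 + c k * m)\<bar> \<le> Ep * (b k)\<^sup>2 * (2 * e + 1 / n)"
    using Ep by (intro mult_left_mono) auto
  moreover have "\<bar>gamma_lmmse n Ep b A \<psi> k - gamma_bar n Ep b A k\<bar>
      = Ep * (b k)\<^sup>2 * \<bar>q k / (1 + c k * q k) - m / (1 + c k * m)\<bar>"
    unfolding g1 g2 right_diff_distrib[symmetric] abs_mult using Ep by simp
  ultimately show ?thesis by simp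
qed

text \<open>Written as b k times u / (1 + u) with u = Ep (b k) m > 0. For a fixed sensor the bound b
  k does not vary with \<tau>, which is what passing to squares requires.\<close>

lemma gamma_bar_bounds:
  fixes b :: "'s \<Rightarrow> real"
  assumes A: "finite A" "k \<in> A" and Ep: "0 < Ep" and b: "\<And>j. j \<in> A \<Longrightarrow> 0 < b j" and n: "0 < n"
  shows "0 \<le> gamma_bar n Ep b A k" "gamma_bar n Ep b A k \<le> b k"
proof -
  define m where "m = Z_det n Ep b (A - {k})"
  have m: "0 < m" unfolding m_def using A Ep b n by (intro Z_det_fix_map) auto
  have g: "gamma_bar n Ep b A k = b k * (Ep * b k * m / (1 + Ep * b k * m))"
    by (simp add: gamma_bar_def Let_def m_def power2_eq_square mult_ac)
  have c: "0 < Ep * b k * m" using Ep b[OF A(2)] m by simp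
  then have r: "0 \<le> Ep * b k * m / (1 + Ep * b k * m)" "Ep * b k * m / (1 + Ep * b k * m) \<le> 1" by auto
  show "0 \<le> gamma_bar n Ep b A k"
    unfolding g using b[OF A(2)] by (intro mult_nonneg_nonneg r) simp
  show "gamma_bar n Ep b A k \<le> b k"
    unfolding g using b[OF A(2)] by (intro mult_left_le r) simp
qed

section \<open>Summability and passage to the squared sum\<close>

lemma summable_linear_exp:
  fixes \<tau> :: "nat \<Rightarrow> nat" and a C :: real
  assumes \<tau>: "strict_mono \<tau>" and a: "0 < a" and C: "0 \<le> C"
  shows "summable (\<lambda>n. C * \<tau> n * exp (- a * \<tau> n))"
proof (rule summable_comparison_test')
  show "summable (\<lambda>n. C * (2 / a) * exp (- a / 2) ^ n)"
    using a by (intro summable_mult summable_geometric) simp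
  fix n :: nat
  have n: "n \<le> \<tau> n" using \<tau> by (rule strict_mono_imp_increasing)
  \<comment> \<open>Half of the decay rate is spent on absorbing the linear factor; the other half,
    with n \<le> \<tau> n, leaves a geometric series.\<close>
  have "\<tau> n * (a / 2) \<le> exp (\<tau> n * (a / 2))" using exp_ge_add_one_self[of "\<tau> n * (a / 2)"] by linarith
  then have "\<tau> n \<le> 2 / a * exp (\<tau> n * (a / 2))" using a by (simp add: field_simps)
  then have "\<tau> n * exp (- a * \<tau> n) \<le> 2 / a * exp (\<tau> n * (a / 2)) * exp (- a * \<tau> n)"
    by (rule mult_right_mono) simp
  also have "\<dots> = 2 / a * exp (- (\<tau> n * (a / 2)))"
    by (simp add: mult.assoc exp_add[symmetric])
  also have "\<dots> \<le> 2 / a * exp (- (n * (a / 2)))" using n a by (intro mult_left_mono) auto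
  also have "exp (- (n * (a / 2))) = exp (- a / 2) ^ n"
    by (simp add: exp_of_nat_mult[symmetric])
  finally have "C * (\<tau> n * exp (- a * \<tau> n)) \<le> C * (2 / a * exp (- a / 2) ^ n)"
    using C by (intro mult_left_mono)
  then show "norm (C * \<tau> n * exp (- a * \<tau> n)) \<le> C * (2 / a) * exp (- a / 2) ^ n"
    using C by (simp add: abs_mult mult.assoc)
qed

text \<open>From x^2 - y^2 = (x - y)^2 + 2 (x - y) y, a bound on the deterministic sequence y
  suffices and none on x is required.\<close>

lemma tendsto_square_diff:
  fixes x y :: "nat \<Rightarrow> real"
  assumes "(\<lambda>n. x n - y n) \<longlonglongrightarrow> 0" and "\<And>n. \<bar>y n\<bar> \<le> B"
  shows "(\<lambda>n. (x n)\<^sup>2 - (y n)\<^sup>2) \<longlonglongrightarrow> 0"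
proof -
  have "(\<lambda>n. (x n - y n) * y n) \<longlonglongrightarrow> 0"
  proof (rule tendsto_0_le[OF assms(1), where K = B])
    show "\<forall>\<^sub>F n in sequentially. norm ((x n - y n) * y n) \<le> norm (x n - y n) * B"
      using assms(2) by (intro always_eventually) (simp add: abs_mult mult_left_mono)
  qed
  then have "(\<lambda>n. (x n - y n)\<^sup>2 + 2 * ((x n - y n) * y n)) \<longlonglongrightarrow> 0\<^sup>2 + 2 * 0"
    by (intro tendsto_intros assms(1))
  moreover have "(x n)\<^sup>2 - (y n)\<^sup>2 = (x n - y n)\<^sup>2 + 2 * ((x n - y n) * y n)" for n
    by (simp add: power2_eq_square algebra_simps)
  ultimately show ?thesis by simp
qed

theorem mainTheorem2:
  fixes M :: "'w measure"
    and L N :: nat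
    and \<beta> \<eta> :: "nat \<Rightarrow> 's \<Rightarrow> real"
    and K K\<^sub>a :: "nat \<Rightarrow> 's set"
    and \<tau> T\<^sub>c :: "nat \<Rightarrow> nat"
    and \<rho>\<^sub>p :: "nat \<Rightarrow> real"
    and \<alpha> \<kappa> E\<^sub>p \<sigma> \<delta> \<Delta> \<zeta> \<rho>\<^sub>d :: real
    and \<psi> :: "nat \<Rightarrow> 's \<Rightarrow> 'w \<Rightarrow> nat \<Rightarrow> complex"
    and k :: 's
  assumes "prob_space M"
    and "\<delta> \<in> {0, 1}" and "0 < \<zeta>" and "\<zeta> < 1" and "0 < \<rho>\<^sub>d" and "0 < \<sigma>\<^sup>2"
    and "\<And>n. finite (K\<^sub>a n)" and "\<And>n. K\<^sub>a n \<subseteq> K n"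
    and "\<And>n l j. l \<in> {1..L} \<Longrightarrow> j \<in> K n \<Longrightarrow> 0 < \<beta> l j"
    and "\<And>n l j. l \<in> {1..L} \<Longrightarrow> j \<in> K n \<Longrightarrow> 0 \<le> \<eta> l j"
    and "strict_mono \<tau>"
    and "\<And>n. 0 < T\<^sub>c n" and "\<And>n. real (\<tau> n) / real (T\<^sub>c n) = \<alpha>"
    and "0 < \<kappa>" and "\<And>n. real (\<tau> n) / real (card (K\<^sub>a n)) = \<kappa>"
    and "\<And>n. 0 < \<rho>\<^sub>p n" and "\<And>n. real (\<tau> n) * \<rho>\<^sub>p n / \<sigma>\<^sup>2 = E\<^sub>p"
    and "\<And>n j. j \<in> K n \<Longrightarrow> distributed M (complex_space (\<tau> n)) (\<psi> n j)
           (complex_normal_density (\<tau> n) (complex_of_real (1 / real (\<tau> n)) \<cdot>\<^sub>m 1\<^sub>m (\<tau> n)))"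
    and "\<And>n. prob_space.indep_vars M (\<lambda>_. complex_space (\<tau> n)) (\<psi> n) (K n)"
    and "\<And>n l. l \<in> {1..L} \<Longrightarrow> AE \<omega> in M.
           (\<Sum>j\<in>K\<^sub>a n. \<delta> * indicator (K\<^sub>a n) j * \<eta> l j
              * gamma_lmmse (\<tau> n) E\<^sub>p (\<beta> l) (K\<^sub>a n) (\<lambda>i. \<psi> n i \<omega>) j) \<le> 1"
    and "\<And>n. k \<in> K\<^sub>a n"
  shows "AE \<omega> in M.
    (\<lambda>n. energy \<alpha> \<Delta> \<zeta> \<delta> (indicator (K\<^sub>a n) k) \<rho>\<^sub>d N L (\<lambda>l. \<eta> l k)
             (\<lambda>l. gamma_lmmse (\<tau> n) E\<^sub>p (\<beta> l) (K\<^sub>a n) (\<lambda>i. \<psi> n i \<omega>) k)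
         - energy \<alpha> \<Delta> \<zeta> \<delta> (indicator (K\<^sub>a n) k) \<rho>\<^sub>d N L (\<lambda>l. \<eta> l k)
             (\<lambda>l. gamma_bar (\<tau> n) E\<^sub>p (\<beta> l) (K\<^sub>a n) k)) \<longlonglongrightarrow> 0"
proof -
  interpret prob_space M by fact
  note fin = assms(7) and sub = assms(8) and bpos = assms(9) and kK = assms(21)
  have \<tau>pos: "0 < \<tau> n" for n
    using assms(14) assms(15)[of n] by (cases "\<tau> n = 0") auto
  have Ep: "0 < E\<^sub>p"
    unfolding assms(17)[of 0, symmetric] using \<tau>pos[of 0] assms(16)[of 0] assms(6)
    by (intro divide_pos_pos mult_pos_pos) auto
  \<comment> \<open>An empty active set would make the quotient 0 by the convention for division,
    against \<kappa> > 0.\<close>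
  have card: "real (card (K\<^sub>a n)) = \<tau> n / \<kappa>" for n
    using assms(15)[of n] assms(14) by (cases "card (K\<^sub>a n) = 0") (auto simp: field_simps)
  have bA: "0 < \<beta> l j" if "l \<in> {1..L}" "j \<in> K\<^sub>a n" for l j n
    using bpos[OF that(1)] sub that(2) by blast
  define D where "D l n j \<omega> = deviation (\<tau> n) (gram (\<lambda>j. E\<^sub>p * \<beta> l j) (K\<^sub>a n - {k} - {j}) (\<lambda>i. \<psi> n i \<omega>)) (\<psi> n j \<omega>)"
    for l n j \<omega>
  \<comment> \<open>The accuracies 1 / Suc m form a countable family, so the exceptional null sets
    can be united; each is at most 2, as the Chernoff bound demands.\<close>
  define bad where "bad l m n = (\<Union>j\<in>K\<^sub>a n. {\<omega> \<in> space M. 1 / Suc m \<le> \<bar>D l n j \<omega>\<bar>})" for l m n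
  have ev: "{\<omega> \<in> space M. 1 / Suc m \<le> \<bar>D l n j \<omega>\<bar>} \<in> events"
    "prob {\<omega> \<in> space M. 1 / Suc m \<le> \<bar>D l n j \<omega>\<bar>} \<le> 2 * exp (- real (\<tau> n) * (1 / Suc m)\<^sup>2 / 8)"
    if "l \<in> {1..L}" "j \<in> K\<^sub>a n" for l m n j
  proof -
    have "0 < 1 / real (Suc m)" "1 / real (Suc m) \<le> 2" by (auto simp: field_simps)
    moreover have "j \<notin> K\<^sub>a n - {k} - {j}" "insert j (K\<^sub>a n - {k} - {j}) \<subseteq> K n" using sub that by auto
    moreover have "0 < E\<^sub>p * \<beta> l i" if "i \<in> K\<^sub>a n - {k} - {j}" for i
      using Ep bA \<open>l \<in> {1..L}\<close> that by auto
    moreover have "j \<in> K n" using sub that by auto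
    ultimately show "{\<omega> \<in> space M. 1 / Suc m \<le> \<bar>D l n j \<omega>\<bar>} \<in> events"
      "prob {\<omega> \<in> space M. 1 / Suc m \<le> \<bar>D l n j \<omega>\<bar>} \<le> 2 * exp (- real (\<tau> n) * (1 / Suc m)\<^sup>2 / 8)"
      using prob_deviation_le[where n = "\<tau> n" and \<epsilon> = "1 / Suc m" and j = j and J = "K\<^sub>a n - {k} - {j}"
          and K = "K n" and c = "\<lambda>j. E\<^sub>p * \<beta> l j" and \<psi> = "\<psi> n", OF \<tau>pos _ _ _ _ _ assms(18) assms(19)]
      unfolding D_def by blast+
  qed
  have AE_bad: "AE \<omega> in M. eventually (\<lambda>n. \<omega> \<in> space M - bad l m n) sequentially" if l: "l \<in> {1..L}" for l m
  proof (rule borel_cantelli_AE1)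
    let ?a = "(1 / real (Suc m))\<^sup>2 / 8"
    show "bad l m n \<in> events" for n unfolding bad_def using ev(1)[OF l] fin by (intro sets.finite_UN) auto
    show "emeasure M (bad l m n) < \<infinity>" for n by (simp add: less_top[symmetric])
    show "summable (\<lambda>n. prob (bad l m n))"
    proof (rule summable_comparison_test')
      show "summable (\<lambda>n. 2 / \<kappa> * \<tau> n * exp (- ?a * \<tau> n))"
        using assms(14) by (intro summable_linear_exp assms(11)) auto
      fix n
      have "prob (bad l m n) \<le> (\<Sum>j\<in>K\<^sub>a n. prob {\<omega> \<in> space M. 1 / Suc m \<le> \<bar>D l n j \<omega>\<bar>})"
        unfolding bad_def using ev(1)[OF l] fin by (intro finite_measure_subadditive_finite) auto
      also have "\<dots> \<le> (\<Sum>j\<in>K\<^sub>a n. 2 * exp (- real (\<tau> n) * (1 / Suc m)\<^sup>2 / 8))"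
        by (intro sum_mono ev(2)[OF l])
      \<comment> \<open>The union bound costs a factor \<open>card (K\<^sub>a n)\<close>, which the
        fixed ratio \<kappa> makes linear in \<tau>.\<close>
      also have "\<dots> = 2 / \<kappa> * \<tau> n * exp (- ?a * \<tau> n)"
        by (simp add: card mult.commute)
      finally show "norm (prob (bad l m n)) \<le> 2 / \<kappa> * \<tau> n * exp (- ?a * \<tau> n)" by simp
    qed
  qed
  have "AE \<omega> in M. \<forall>l\<in>{1..L}. \<forall>m. eventually (\<lambda>n. \<omega> \<in> space M - bad l m n) sequentially"
    using AE_bad unfolding AE_ball_countable[OF countable_finite[OF finite_atLeastAtMost]] AE_all_countable by blast
  then show ?thesis
  proof eventually_elim
    case (elim \<omega>)
    define x where "x l n = gamma_lmmse (\<tau> n) E\<^sub>p (\<beta> l) (K\<^sub>a n) (\<lambda>i. \<psi> n i \<omega>) k" for l n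
    define y where "y l n = gamma_bar (\<tau> n) E\<^sub>p (\<beta> l) (K\<^sub>a n) k" for l n
    have xy: "(\<lambda>n. x l n - y l n) \<longlonglongrightarrow> 0" if l: "l \<in> {1..L}" for l
    proof (rule LIMSEQ_I)
      fix r :: real assume r: "0 < r"
      define C where "C = E\<^sub>p * (\<beta> l k)\<^sup>2"
      have C: "0 \<le> C" using Ep by (simp add: C_def)
      \<comment> \<open>Chosen so that 3 C / Suc m < r: outside the bad event the error is C (2 e +
        1 / \<tau>), and both e and 1 / \<tau> will be at most 1 / Suc m.\<close>
      obtain m where m: "(3 * C + 1) / r < real m" using reals_Archimedean2 by blast
      then have "3 * C + 1 < r * m" using r by (simp add: field_simps)
      then have Cm: "C * (3 / Suc m) < r" using r by (simp add: field_simps)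
      have "eventually (\<lambda>n. \<omega> \<in> space M - bad l m n \<and> Suc m \<le> n) sequentially"
        using elim l eventually_ge_at_top by (intro eventually_conj) auto
      then have "eventually (\<lambda>n. norm (x l n - y l n - 0) < r) sequentially"
      proof eventually_elim
        case (elim n)
        have "Suc m \<le> \<tau> n" using elim strict_mono_imp_increasing[OF assms(11), of n] by simp
        then have t: "1 / real (\<tau> n) \<le> 1 / Suc m" by (intro divide_left_mono) auto
        have "\<bar>x l n - y l n\<bar> \<le> C * (2 * (1 / Suc m) + 1 / \<tau> n)"
          unfolding x_def y_def C_def
        proof (rule gamma_lmmse_approx[OF fin kK Ep bA[OF l] \<tau>pos])
          fix j assume "j \<in> K\<^sub>a n"
          then have "\<not> 1 / Suc m \<le> \<bar>D l n j \<omega>\<bar>" using elim by (auto simp: bad_def)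
          then show "\<bar>deviation (\<tau> n) (gram (\<lambda>j. E\<^sub>p * \<beta> l j) (K\<^sub>a n - {k} - {j}) (\<lambda>i. \<psi> n i \<omega>)) (\<psi> n j \<omega>)\<bar> \<le> 1 / Suc m"
            by (simp add: D_def)
        qed
        also have "\<dots> \<le> C * (3 / Suc m)" using t C by (intro mult_left_mono) auto
        finally show ?case using Cm by simp
      qed
      then show "\<exists>no. \<forall>n\<ge>no. norm (x l n - y l n - 0) < r" by (simp add: eventually_sequentially)
    qed
    have yb: "\<bar>y l n\<bar> \<le> \<beta> l k" if l: "l \<in> {1..L}" for l n
      using gamma_bar_bounds[OF fin kK Ep bA[OF l] \<tau>pos, of n] by (simp add: y_def)
    define X where "X n = (\<Sum>l=1..L. sqrt (\<eta> l k) * x l n)" for n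
    define Y where "Y n = (\<Sum>l=1..L. sqrt (\<eta> l k) * y l n)" for n
    have "(\<lambda>n. \<Sum>l=1..L. sqrt (\<eta> l k) * (x l n - y l n)) \<longlonglongrightarrow> (\<Sum>l=1..L. sqrt (\<eta> l k) * 0)"
      by (intro tendsto_intros xy)
    then have "(\<lambda>n. X n - Y n) \<longlonglongrightarrow> 0"
      by (simp add: X_def Y_def sum_subtractf right_diff_distrib)
    moreover have "\<bar>Y n\<bar> \<le> (\<Sum>l=1..L. \<bar>sqrt (\<eta> l k)\<bar> * \<beta> l k)" for n
      unfolding Y_def by (rule order_trans[OF sum_abs]) (auto simp: abs_mult intro!: sum_mono mult_left_mono yb)
    ultimately have "(\<lambda>n. (X n)\<^sup>2 - (Y n)\<^sup>2) \<longlonglongrightarrow> 0" by (rule tendsto_square_diff)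
    then have "(\<lambda>n. (1 - \<alpha>) * \<Delta> * \<zeta> * \<delta> * \<rho>\<^sub>d * (real N)\<^sup>2 * ((X n)\<^sup>2 - (Y n)\<^sup>2)) \<longlonglongrightarrow> 0"
      by (rule tendsto_mult_right_zero)
    then show ?case
      using kK by (simp add: energy_def X_def Y_def x_def y_def right_diff_distrib)
  qed
qed

end
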